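(* Let $\beta>1$ be a quadratic algebraic number, i.e. a real algebraic number of degree exactly $2$ over $\mathbb{Q}$. Then there exists $\alpha\in[0,1]$ such that $T_\alpha$ has matching if and only if $\beta$ is a Pisot number. Moreover, if $\beta$ is a Pisot number, then there are positive integers $k,d$ such that either $\beta^2-k\beta+d=0$ with $k>d+1$, or $\beta^2-k\beta-d=0$ with $k>d-1$, and in either case $$\dim_H(A_\beta)=\frac{\log d}{\log\beta}.$$
   Context: For $\beta>1$ fixed and $\alpha\in[0,1]$, let $T_\alpha$ be the map $T_\alpha(x)=\beta x+\alpha \pmod 1$ on the circle $\mathbb{R}/\mathbb{Z}$, with points represented by $x\in[0,1)$ when applying the formula and values again taken in $[0,1)$. The point $0$ is the discontinuity; write $0^+=\lim_{x\downarrow 0}x$ and $0^-=\lim_{x\uparrow 1}x$. Their orbits are: $T_\alpha^n(0^+)=T_\alpha^n(0)$ for $n\ge 1$; $T_\alpha(0^-)=\beta+\alpha \pmod 1\in[0,1)$ and $T_\alpha^{n}(0^-)=T_\alpha^{n-1}(T_\alpha(0^-))$ for $n\ge 2$. $T_\alpha$ has matching if there is an integer $m\ge 1$ with $T_\alpha^m(0^+)=T_\alpha^m(0^-)$. The non-matching (bifurcation) set is $$A_\beta=\{\alpha\in[0,1] : T_\alpha \text{ does not have matching}\}.$$ $\dim_H$ denotes Hausdorff dimension. A Pisot number is an algebraic integer $\beta>1$ all of whose other Galois conjugates lie strictly inside the unit disk. *)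

theory Defs
  imports "HOL-Analysis.Analysis" "HOL-Computational_Algebra.Computational_Algebra"
begin

definition is_min_poly :: "rat poly \<Rightarrow> 'a::field_char_0 \<Rightarrow> bool" where
  "is_min_poly p x \<longleftrightarrow>
     lead_coeff p = 1 \<and> irreducible p \<and> poly (map_poly of_rat p) x = 0"

definition has_algebraic_degree :: "'a::field_char_0 \<Rightarrow> nat \<Rightarrow> bool" where
  "has_algebraic_degree x n \<longleftrightarrow> (\<exists>p. is_min_poly p x \<and> degree p = n)"

definition galois_conjugates :: "real \<Rightarrow> complex set" where
  "galois_conjugates x =
     {z. \<exists>p. is_min_poly p x \<and> poly (map_poly of_rat p) z = 0}"

definition pisot :: "real \<Rightarrow> bool" where
  "pisot \<beta> \<longleftrightarrow> algebraic_int \<beta> \<and> \<beta> > 1 \<and>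
     (\<forall>z\<in>galois_conjugates \<beta> - {complex_of_real \<beta>}. norm z < 1)"

text \<open>
  The case distinction gives the usual conventions: the empty set costs \<open>0\<close>, and for \<open>s = 0\<close>
  every nonempty set costs \<open>1\<close> (whereas \<open>0 powr 0 = 0\<close>).
\<close>
definition hausdorff_cost :: "real \<Rightarrow> 'a::metric_space set \<Rightarrow> ennreal" where
  "hausdorff_cost s U =
     (if U = {} then 0 else if s = 0 then 1 else ennreal (diameter U powr s))"

text \<open>Boundedness is required since \<open>diameter\<close> is meaningless on unbounded sets.\<close>
definition hausdorff_premeasure :: "real \<Rightarrow> real \<Rightarrow> 'a::metric_space set \<Rightarrow> ennreal" where
  "hausdorff_premeasure s \<delta> A =
     (INF U \<in> {U :: nat \<Rightarrow> 'a set. A \<subseteq> (\<Union>i. U i) \<and> (\<forall>i. bounded (U i) \<and> diameter (U i) \<le> \<delta>)}.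
        \<Sum>i. hausdorff_cost s (U i))"

definition hausdorff_measure :: "real \<Rightarrow> 'a::metric_space set \<Rightarrow> ennreal" where
  "hausdorff_measure s A = (SUP \<delta> \<in> {0<..}. hausdorff_premeasure s \<delta> A)"

definition hausdorff_dim :: "'a::metric_space set \<Rightarrow> ereal" where
  "hausdorff_dim A = (INF s \<in> {s. 0 \<le> s \<and> hausdorff_measure s A = 0}. ereal s)"

definition T :: "real \<Rightarrow> real \<Rightarrow> real \<Rightarrow> real" where
  "T \<beta> \<alpha> x = frac (\<beta> * x + \<alpha>)"

text \<open>
  The orbits of \<open>0\<^sup>+\<close> and \<open>0\<^sup>-\<close>, meaningful for \<open>n \<ge> 1\<close> only: the circle points \<open>0\<^sup>+\<close> and \<open>0\<^sup>-\<close>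
  themselves coincide.
\<close>
definition orbit_plus :: "real \<Rightarrow> real \<Rightarrow> nat \<Rightarrow> real" where
  "orbit_plus \<beta> \<alpha> n = (T \<beta> \<alpha> ^^ n) 0"

definition orbit_minus :: "real \<Rightarrow> real \<Rightarrow> nat \<Rightarrow> real" where
  "orbit_minus \<beta> \<alpha> n = (T \<beta> \<alpha> ^^ (n - 1)) (frac (\<beta> + \<alpha>))"

definition matching :: "real \<Rightarrow> real \<Rightarrow> bool" where
  "matching \<beta> \<alpha> \<longleftrightarrow> (\<exists>m\<ge>1. orbit_plus \<beta> \<alpha> m = orbit_minus \<beta> \<alpha> m)"

definition non_matching_set :: "real \<Rightarrow> real set" where
  "non_matching_set \<beta> = {\<alpha>\<in>{0..1}. \<not> matching \<beta> \<alpha>}"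

end

theory Submission
  imports Defs "HOL-Real_Asymp.Real_Asymp"
begin

text \<open>
  Let \<open>\<delta>\<^sub>n = T\<^sup>n(0\<^sup>-) - T\<^sup>n(0\<^sup>+)\<close>. Then \<open>\<delta>\<^sub>1\<close> differs from \<open>\<beta>\<close>, and \<open>\<delta>\<^sub>n\<^sub>+\<^sub>1\<close>
  from \<open>\<beta> \<delta>\<^sub>n\<close>, by an integer, so \<open>\<delta>\<^sub>n\<close> is a monic integer polynomial in \<open>\<beta>\<close>, and \<open>\<bar>\<delta>\<^sub>n\<bar> < 1\<close>.

  Matching forces \<open>\<delta>\<^sub>n = 0\<close> for some \<open>n\<close>. Hence \<open>\<beta>\<close> is an algebraic integer, \<open>\<beta>\<^sup>2 = k \<beta> - D\<close>, with
  conjugate \<open>k - \<beta>\<close>. At the first zero \<open>\<delta>\<^sub>n\<^sub>+\<^sub>1 = 0\<close> the number \<open>\<beta> \<delta>\<^sub>n\<close> is an integer; as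
  \<open>\<delta>\<^sub>n = p \<beta> + q\<close> with integers \<open>p, q\<close>, this makes \<open>\<delta>\<^sub>n\<close> a nonzero integer multiple of \<open>k - \<beta>\<close>. So
  \<open>\<bar>k - \<beta>\<bar> < 1\<close>, that is, \<open>\<beta>\<close> is Pisot (\<open>pisot_of_matching\<close>).

  Conversely let \<open>\<beta>\<close> be Pisot and put \<open>\<kappa> = \<bar>k - \<beta>\<bar>\<close> and \<open>d = \<beta> \<kappa> = \<bar>D\<bar>\<close>. Consider
  the pair formed by a point \<open>z\<close> of \<open>[0,1)\<close> and the representative of \<open>z - \<kappa>\<close> modulo \<open>1\<close>. If \<open>z \<ge> \<kappa>\<close>, then
  \<open>T\<close> merges the two points, because they differ by \<open>\<kappa>\<close> and \<open>\<beta> \<kappa>\<close> is an integer. If \<open>z < \<kappa>\<close>, they differ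
  by \<open>1 - \<kappa>\<close>, and \<open>T\<close> maps the pair to another pair of this form. The orbits of \<open>0\<^sup>+\<close> and \<open>0\<^sup>-\<close> start as
  such a pair, so they match exactly when its point \<open>z\<close> leaves \<open>[0,\<kappa>)\<close>. Until then \<open>z\<close> follows
  one autonomous orbit: the orbit of \<open>0\<close> under \<open>T\<close> with parameter \<open>\<alpha> + v\<close>, where \<open>v = 0\<close> if the
  conjugate is positive and \<open>v = \<kappa>\<close> if it is negative (\<open>matching_iff_orbit_plus\<close>). In particular
  some \<open>\<alpha>\<close> has matching.

  It remains to find the dimension of the set of parameters \<open>a\<close> for which the orbit of \<open>0\<close> stays in
  \<open>[0, d / \<beta>)\<close>. On that interval the map winds exactly \<open>d\<close> times around the circle. Making it constant on the
  complementary hole gives a continuous monotone circle map of degree \<open>d\<close>; let \<open>X\<^sub>n(a)\<close> be the lift to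
  the line of its orbit of \<open>0\<close>.

  Upper bound: over a unit interval of parameters \<open>X\<^sub>n\<close> grows by about \<open>d\<^sup>n\<close>, while it is affine of
  slope about \<open>\<beta>\<^sup>n\<close> on surviving parameters with equal integer parts \<open>\<lfloor>X\<^sub>j\<rfloor>\<close>. Hence at most a
  polynomial multiple of \<open>d\<^sup>n\<close> sets of diameter \<open>\<beta>\<^sup>-\<^sup>n\<close> cover the surviving set
  (\<open>hausdorff_measure_survivors_eq_0\<close>).

  Lower bound, for \<open>d \<ge> 2\<close>: the limit of \<open>X\<^sub>n / d\<^sup>n\<close> is a Hoelder function of \<open>a\<close> with exponent
  \<open>ln d / ln \<beta>\<close>. When the orbit falls into the hole it becomes periodic, so the limit is rational there; the
  surviving parameters therefore already map onto an interval up to a countable set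
  (\<open>hausdorff_measure_survivors_neq_0\<close>).
\<close>

section \<open>Bounds for the Hausdorff dimension\<close>

lemma hausdorff_dim_leI:
  assumes "0 \<le> s0" "\<And>s. s0 < s \<Longrightarrow> hausdorff_measure s A = 0"
  shows "hausdorff_dim A \<le> ereal s0"
proof (rule ereal_le_epsilon2)
  fix e :: real assume "0 < e"
  then show "hausdorff_dim A \<le> ereal s0 + ereal e"
    unfolding hausdorff_dim_def using assms by (intro INF_lower2[of "s0 + e"]) auto
qed

lemma hausdorff_dim_geI:
  assumes "\<And>s. 0 \<le> s \<Longrightarrow> s < s0 \<Longrightarrow> hausdorff_measure s A \<noteq> 0"
  shows "ereal s0 \<le> hausdorff_dim A"
  unfolding hausdorff_dim_def using assms by (intro INF_greatest) (auto simp: not_less[symmetric])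

text \<open>
  A finite cover is padded with empty sets, which cost nothing, to a sequence as in the definition of the
  premeasure.
\<close>
lemma hausdorff_measure_eq_0I:
  assumes s: "0 < s"
    and cover: "\<And>\<delta> \<epsilon>. 0 < \<delta> \<Longrightarrow> 0 < \<epsilon> \<Longrightarrow> \<exists>(N :: nat) (U :: nat \<Rightarrow> 'a::metric_space set) r. r \<le> \<delta> \<and> A \<subseteq> (\<Union>i<N. U i) \<and>
      (\<forall>i<N. bounded (U i) \<and> diameter (U i) \<le> r) \<and> N * r powr s \<le> \<epsilon>"
  shows "hausdorff_measure s A = 0"
proof -
  have "hausdorff_premeasure s \<delta> A \<le> 0" if \<delta>: "0 < \<delta>" for \<delta>
  proof (rule ennreal_le_epsilon)
    fix \<epsilon> :: real assume \<epsilon>: "0 < \<epsilon>"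
    obtain N :: nat and U :: "nat \<Rightarrow> 'a set" and r where r: "r \<le> \<delta>" and A: "A \<subseteq> (\<Union>i<N. U i)"
      and U: "\<And>i. i < N \<Longrightarrow> bounded (U i)" "\<And>i. i < N \<Longrightarrow> diameter (U i) \<le> r"
      and small: "N * r powr s \<le> \<epsilon>"
      using cover[OF \<delta> \<epsilon>] by (elim exE conjE) blast
    define V where "V = (\<lambda>i. if i < N then U i else {})"
    have "hausdorff_premeasure s \<delta> A \<le> (\<Sum>i. hausdorff_cost s (V i))"
      unfolding hausdorff_premeasure_def
    proof (rule INF_lower, safe)
      show "x \<in> (\<Union>i. V i)" if "x \<in> A" for x
        using A that by (auto simp: V_def split: if_splits)
      show "bounded (V i)" for i using U by (simp add: V_def)
      show "diameter (V i) \<le> \<delta>" for i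
        using U(2)[of i] r \<delta> by (auto simp: V_def)
    qed
    also have "\<dots> = (\<Sum>i<N. hausdorff_cost s (V i))"
      by (rule suminf_finite) (auto simp: V_def hausdorff_cost_def)
    also have "\<dots> \<le> (\<Sum>i<N. ennreal (r powr s))"
    proof (rule sum_mono)
      fix i assume "i \<in> {..<N}"
      then have "diameter (U i) powr s \<le> r powr s"
        using U s by (intro powr_mono2) (auto simp: diameter_ge_0)
      then show "hausdorff_cost s (V i) \<le> ennreal (r powr s)"
        using \<open>i \<in> {..<N}\<close> s by (auto simp: hausdorff_cost_def V_def ennreal_leI)
    qed
    also have "\<dots> = ennreal (N * r powr s)"
      by (simp add: ennreal_mult ennreal_of_nat_eq_real_of_nat)
    also have "\<dots> \<le> 0 + ennreal \<epsilon>" using small by (simp add: ennreal_leI)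
    finally show "hausdorff_premeasure s \<delta> A \<le> 0 + ennreal \<epsilon>" .
  qed
  then have "hausdorff_measure s A \<le> 0"
    unfolding hausdorff_measure_def by (intro SUP_least) simp
  then show ?thesis by simp
qed

text \<open>
  The mass distribution principle without a measure on \<open>A\<close>. A cover of \<open>A\<close> of small cost is
  carried by the Hoelder map \<open>f\<close> to a cover of an interval of positive length, up to a countable set, by
  intervals of total length at most \<open>2 * C\<close> times that cost.
\<close>
lemma hausdorff_measure_neq_0_of_holder:
  fixes f :: "'a::metric_space \<Rightarrow> real"
  assumes holder: "\<And>x y. x \<in> A \<Longrightarrow> y \<in> A \<Longrightarrow> dist x y \<le> 1 \<Longrightarrow> dist (f x) (f y) \<le> C * dist x y powr t"
    and C: "0 \<le> C" and s: "0 \<le> s" "s < t"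
    and fill: "{p..q} \<subseteq> f ` A \<union> K" "countable K" "p < q"
  shows "hausdorff_measure s A \<noteq> 0"
proof
  assume "hausdorff_measure s A = 0"
  then have "hausdorff_premeasure s 1 A \<le> 0"
    unfolding hausdorff_measure_def by (metis SUP_upper greaterThan_iff zero_less_one)
  \<comment> \<open>The images of a cover of cost below \<open>\<epsilon>\<close> have total length below \<open>q - p\<close>;
    the summand \<open>1\<close> keeps the quotient defined for \<open>C = 0\<close>.\<close>
  define \<epsilon> where "\<epsilon> = (q - p) / (2 * C + 1)"
  have \<epsilon>: "0 < \<epsilon>" "2 * C * \<epsilon> < q - p"
    using C fill(3) by (auto simp: \<epsilon>_def field_simps)
  have "hausdorff_premeasure s 1 A < ennreal \<epsilon>"
    using \<open>hausdorff_premeasure s 1 A \<le> 0\<close> \<epsilon>(1) by (metis ennreal_less_zero_iff le_zero_eq)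
  then obtain U :: "nat \<Rightarrow> 'a set" where U: "A \<subseteq> (\<Union>i. U i)" "\<And>i. bounded (U i)"
      "\<And>i. diameter (U i) \<le> 1" "(\<Sum>i. hausdorff_cost s (U i)) < ennreal \<epsilon>"
    unfolding hausdorff_premeasure_def INF_less_iff by auto
  define x where "x = (\<lambda>i. SOME x. x \<in> U i \<inter> A)"
  define V where "V = (\<lambda>i. if U i \<inter> A = {} then {} else cball (f (x i)) (C * diameter (U i) powr t))"
  have x: "x i \<in> U i \<inter> A" if "U i \<inter> A \<noteq> {}" for i
    using that unfolding x_def by (metis ex_in_conv someI_ex)
  have cost: "emeasure lborel (V i) \<le> ennreal (2 * C) * hausdorff_cost s (U i)" for i
  proof (cases "U i \<inter> A = {}")
    case False
    have D: "0 \<le> diameter (U i)" using U(2) by (rule diameter_ge_0)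
    \<comment> \<open>Diameters at most \<open>1\<close> let the exponent drop from \<open>t\<close> to \<open>s\<close>.\<close>
    have "ennreal (diameter (U i) powr t) \<le> hausdorff_cost s (U i)"
      using False s D U(3)[of i] powr_mono'[of s t "diameter (U i)"] powr_le1[of t "diameter (U i)"]
      by (auto simp: hausdorff_cost_def ennreal_leI)
    then have "ennreal (2 * C) * ennreal (diameter (U i) powr t)
        \<le> ennreal (2 * C) * hausdorff_cost s (U i)"
      by (rule mult_left_mono) simp
    moreover have "emeasure lborel (V i) = ennreal (2 * C * diameter (U i) powr t)"
      using False C by (simp add: V_def cball_eq_atLeastAtMost)
    ultimately show ?thesis using C by (simp add: ennreal_mult)
  qed (simp add: V_def)
  have "f ` A \<subseteq> (\<Union>i. V i)"
  proof safe
    fix a assume a: "a \<in> A"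
    then obtain i where i: "a \<in> U i" using U(1) by auto
    then have ne: "U i \<inter> A \<noteq> {}" using a by auto
    have d: "dist (x i) a \<le> diameter (U i)"
      using x[OF ne] i U(2) by (intro diameter_bounded_bound) auto
    then have "dist (f (x i)) (f a) \<le> C * dist (x i) a powr t"
      using x[OF ne] a U(3)[of i] by (intro holder) auto
    also have "\<dots> \<le> C * diameter (U i) powr t"
      using d s C by (intro mult_left_mono powr_mono2) auto
    finally show "f a \<in> (\<Union>i. V i)" using ne by (auto simp: V_def)
  qed
  then have sub: "{p..q} \<subseteq> (\<Union>i. V i) \<union> K"
    by (rule subset_trans[OF fill(1) Un_mono[OF _ subset_refl]])
  have meas: "V i \<in> sets lborel" for i by (simp add: V_def)
  have K: "K \<in> null_sets lborel" using fill(2) by (rule countable_imp_null_set_lborel)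
  have "ennreal (q - p) = emeasure lborel {p..q}" using fill(3) by simp
  also have "\<dots> \<le> emeasure lborel ((\<Union>i. V i) \<union> K)"
    using sub meas K by (intro emeasure_mono) auto
  also have "\<dots> = emeasure lborel (\<Union>i. V i)"
    using meas K by (intro emeasure_Un_null_set) auto
  also have "\<dots> \<le> (\<Sum>i. emeasure lborel (V i))"
    using meas by (intro emeasure_subadditive_countably) auto
  also have "\<dots> \<le> (\<Sum>i. ennreal (2 * C) * hausdorff_cost s (U i))"
    using cost by (intro suminf_le) auto
  also have "\<dots> = ennreal (2 * C) * (\<Sum>i. hausdorff_cost s (U i))" by simp
  also have "\<dots> \<le> ennreal (2 * C) * ennreal \<epsilon>" using U(4) by (intro mult_left_mono) auto
  also have "\<dots> = ennreal (2 * C * \<epsilon>)" using C \<epsilon>(1) by (simp add: ennreal_mult)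
  also have "\<dots> < ennreal (q - p)" using \<epsilon>(2) C \<epsilon>(1) by (intro ennreal_lessI) (use fill(3) in auto)
  finally show False by simp
qed

section \<open>The collapsed circle map\<close>

text \<open>
  The lift to the line of \<open>x \<mapsto> \<beta> x\<close> after the hole \<open>[d / \<beta>, 1)\<close> has been collapsed: the value is
  frozen at \<open>d\<close> on the hole, which makes the lift continuous and gives it degree \<open>d\<close>.
\<close>
definition collapsed_lift :: "real \<Rightarrow> nat \<Rightarrow> real \<Rightarrow> real" where
  "collapsed_lift \<beta> d x = d * of_int \<lfloor>x\<rfloor> + min (\<beta> * frac x) d"

text \<open>
  The orbit of \<open>0\<close> under \<open>x \<mapsto> collapsed_lift \<beta> d x + a\<close>, seen as a function of the parameter \<open>a\<close>.
\<close>
primrec lifted_orbit :: "real \<Rightarrow> nat \<Rightarrow> nat \<Rightarrow> real \<Rightarrow> real" where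
  "lifted_orbit \<beta> d 0 a = 0"
| "lifted_orbit \<beta> d (Suc n) a = collapsed_lift \<beta> d (lifted_orbit \<beta> d n a) + a"

text \<open>
  The inequality \<open>d < \<beta>\<close> says that the part \<open>[0, d / \<beta>)\<close> on which the map is not collapsed is a
  proper part of the circle.
\<close>
locale wide_slope =
  fixes \<beta> :: real and d :: nat
  assumes d_pos: "1 \<le> d" and d_less: "d < \<beta>"
begin

abbreviation "g \<equiv> collapsed_lift \<beta> d"
abbreviation "X \<equiv> lifted_orbit \<beta> d"

text \<open>
  The parameters whose orbit never meets the hole. For them the collapsed orbit and the original
  orbit agree modulo \<open>1\<close>.
\<close>
definition survivors :: "real set" where
  "survivors = {a. \<forall>n. frac (X n a) < d / \<beta>}"

text \<open>
  The slope \<open>1 + \<beta> + \<dots> + \<beta>\<^sup>n\<^sup>-\<^sup>1\<close> of \<open>X n\<close> in the parameter while no earlier point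
  of the orbit is in the hole.
\<close>
definition slope :: "nat \<Rightarrow> real" where
  "slope n = (\<beta> ^ n - 1) / (\<beta> - 1)"

lemma beta_gt_1: "1 < \<beta>"
  using d_pos d_less by linarith

lemma slope_Suc: "slope (Suc n) = \<beta> * slope n + 1"
  using beta_gt_1 by (simp add: slope_def field_simps)

lemma power_le_slope_Suc: "\<beta> ^ n \<le> slope (Suc n)"
proof (induction n)
  case 0
  show ?case using beta_gt_1 by (simp add: slope_def)
next
  case (Suc n)
  then have "\<beta> * \<beta> ^ n \<le> \<beta> * slope (Suc n)" using beta_gt_1 by (intro mult_left_mono) auto
  then show ?case using slope_Suc[of "Suc n"] by simp
qed

lemma slope_le: "slope n \<le> \<beta> ^ n / (\<beta> - 1)"
  using beta_gt_1 by (simp add: slope_def divide_right_mono)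

lemma g_add_int: "g (x + of_int m) = g x + d * of_int m"
  by (simp add: collapsed_lift_def algebra_simps)

lemma g_bounds: "real d * of_int \<lfloor>x\<rfloor> \<le> g x" "g x \<le> real d * (of_int \<lfloor>x\<rfloor> + 1)"
  using beta_gt_1 by (auto simp: collapsed_lift_def algebra_simps)

lemma g_approx: "\<bar>g x - real d * x\<bar> \<le> d"
proof -
  have "real d * of_int \<lfloor>x\<rfloor> \<le> real d * x" "real d * x \<le> real d * (of_int \<lfloor>x\<rfloor> + 1)"
    by (intro mult_left_mono; linarith)+
  with g_bounds[of x] show ?thesis by (simp add: algebra_simps abs_le_iff)
qed

text \<open>
  Collapsing can only slow the map down. When \<open>x\<close> and \<open>y\<close> have different integer parts, their increment
  splits into the two boundary pieces and a whole number \<open>k\<close> of full turns, and each turn contributes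
  \<open>d\<close>, which is less than \<open>\<beta>\<close>.
\<close>
lemma g_increment:
  assumes "x \<le> y"
  shows "0 \<le> g y - g x" "g y - g x \<le> \<beta> * (y - x)"
proof -
  have "0 \<le> g y - g x \<and> g y - g x \<le> \<beta> * (y - x)"
  proof (cases "\<lfloor>x\<rfloor> = \<lfloor>y\<rfloor>")
    case True
    then have fr: "frac y - frac x = y - x" by (simp add: frac_def)
    have "0 \<le> \<beta> * (y - x)" using assms beta_gt_1 by simp
    moreover have "\<beta> * frac y = \<beta> * frac x + \<beta> * (y - x)"
      using fr by (metis add.commute diff_add_cancel distrib_left)
    ultimately show ?thesis using True by (auto simp: collapsed_lift_def min_def)
  next
    case False
    with assms have fl: "\<lfloor>x\<rfloor> + 1 \<le> \<lfloor>y\<rfloor>" using floor_mono[OF assms] by linarith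
    define k where "k = real_of_int (\<lfloor>y\<rfloor> - \<lfloor>x\<rfloor> - 1)"
    have k: "0 \<le> k" using fl by (simp add: k_def)
    have "g y - g x = min (\<beta> * frac y) d + d * k + (d - min (\<beta> * frac x) d)"
      by (simp add: collapsed_lift_def k_def algebra_simps)
    moreover have "d * k \<le> \<beta> * k" "0 \<le> d * k" using k d_less by (auto intro: mult_right_mono)
    moreover have "\<beta> * (y - x) = \<beta> * frac y + \<beta> * k + (\<beta> - \<beta> * frac x)"
      by (simp add: k_def frac_def algebra_simps)
    moreover have "0 \<le> \<beta> * frac y" "\<beta> * frac x \<le> \<beta>"
      using beta_gt_1 frac_lt_1[of x] by (auto intro!: mult_left_le less_imp_le)
    ultimately show ?thesis using d_less by linarith
  qed
  then show "0 \<le> g y - g x" "g y - g x \<le> \<beta> * (y - x)" by auto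
qed

lemma X_increment:
  assumes "a \<le> b"
  shows "0 \<le> X n b - X n a" "X n b - X n a \<le> slope n * (b - a)"
proof -
  have "0 \<le> X n b - X n a \<and> X n b - X n a \<le> slope n * (b - a)"
  proof (induction n)
    case 0
    show ?case by (simp add: slope_def)
  next
    case (Suc n)
    then have "0 \<le> g (X n b) - g (X n a)" "g (X n b) - g (X n a) \<le> \<beta> * (X n b - X n a)"
      using g_increment[of "X n a" "X n b"] by auto
    moreover have "\<beta> * (X n b - X n a) \<le> \<beta> * (slope n * (b - a))"
      using Suc beta_gt_1 by (intro mult_left_mono) auto
    ultimately show ?case using assms by (simp add: slope_Suc algebra_simps)
  qed
  then show "0 \<le> X n b - X n a" "X n b - X n a \<le> slope n * (b - a)" by auto
qed

lemma X_add_1: "X n (a + 1) = X n a + real (\<Sum>j<n. d ^ j)"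
proof (induction n)
  case (Suc n)
  have "g (X n (a + 1)) = g (X n a) + d * real (\<Sum>j<n. d ^ j)"
    using g_add_int[of "X n a" "int (\<Sum>j<n. d ^ j)"] Suc by simp
  moreover have "(\<Sum>j<Suc n. d ^ j) = 1 + d * (\<Sum>j<n. d ^ j)"
    unfolding sum.lessThan_Suc_shift by (simp add: sum_distrib_left)
  ultimately show ?case by (simp del: sum.lessThan_Suc of_nat_sum)
qed simp

section \<open>Covering the surviving parameters\<close>

text \<open>
  Each \<open>\<lfloor>X j a\<rfloor>\<close> is monotone in \<open>a\<close>, so the whole vector of these integers is determined by its sum.
  A single integer thus labels the pieces of the cover, and the number of its values is immediate from
  \<open>X_add_1\<close>.
\<close>
definition itinerary_sum :: "nat \<Rightarrow> real \<Rightarrow> int" where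
  "itinerary_sum n a = (\<Sum>j\<le>n. \<lfloor>X j a\<rfloor>)"

lemma itinerary_sum_mono: "a \<le> b \<Longrightarrow> itinerary_sum n a \<le> itinerary_sum n b"
  unfolding itinerary_sum_def using X_increment(1) by (intro sum_mono floor_mono) force

lemma itinerary_sum_add_1:
  "itinerary_sum n (a + 1) = itinerary_sum n a + int (\<Sum>j\<le>n. \<Sum>i<j. d ^ i)"
proof -
  have "\<lfloor>X j (a + 1)\<rfloor> = \<lfloor>X j a\<rfloor> + int (\<Sum>i<j. d ^ i)" for j
    unfolding X_add_1 by (simp only: floor_add_int of_int_of_nat_eq)
  then show ?thesis by (simp add: itinerary_sum_def sum.distrib)
qed

lemma itinerary_count_le: "(\<Sum>j\<le>n. \<Sum>i<j. d ^ i) + 1 \<le> (n + 1)\<^sup>2 * d ^ n"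
proof -
  have "(\<Sum>j\<le>n. \<Sum>i<j. d ^ i) \<le> (\<Sum>j\<le>n. \<Sum>i<j. d ^ n)"
    using d_pos by (intro sum_mono power_increasing) auto
  also have "\<dots> \<le> (\<Sum>j\<le>n. n * d ^ n)"
    by (intro sum_mono) auto
  also have "\<dots> = (n + 1) * n * d ^ n" by (simp add: algebra_simps)
  finally show ?thesis
    using one_le_power[OF d_pos, of n]
    by (simp add: power2_eq_square algebra_simps add_mult_distrib)
qed

lemma floor_X_eq_of_itinerary_sum_eq:
  assumes "a \<le> b" "itinerary_sum n a = itinerary_sum n b" "j \<le> n"
  shows "\<lfloor>X j a\<rfloor> = \<lfloor>X j b\<rfloor>"
proof -
  have le: "\<lfloor>X i a\<rfloor> \<le> \<lfloor>X i b\<rfloor>" for i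
    using X_increment(1)[OF assms(1), of i] by (intro floor_mono) simp
  show ?thesis
    using sum_mono_inv[of "\<lambda>j. \<lfloor>X j a\<rfloor>" "{..n}" "\<lambda>j. \<lfloor>X j b\<rfloor>"] le assms
    by (auto simp: itinerary_sum_def)
qed

lemma X_increment_survivors:
  assumes "a \<in> survivors" "b \<in> survivors" "\<And>j. j < n \<Longrightarrow> \<lfloor>X j a\<rfloor> = \<lfloor>X j b\<rfloor>"
  shows "X n b - X n a = slope n * (b - a)"
  using assms(3)
proof (induction n)
  case 0
  show ?case by (simp add: slope_def)
next
  case (Suc n)
  have "\<beta> * frac (X n c) \<le> d" if "c \<in> survivors" for c
    using that beta_gt_1 by (auto simp: survivors_def field_simps intro: less_imp_le)
  then have "g (X n c) = d * of_int \<lfloor>X n c\<rfloor> + \<beta> * frac (X n c)" if "c \<in> survivors" for c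
    using that by (simp add: collapsed_lift_def min_def)
  moreover have "frac (X n b) - frac (X n a) = X n b - X n a"
    using Suc.prems[of n] by (simp add: frac_def)
  ultimately have "g (X n b) - g (X n a) = \<beta> * (X n b - X n a)"
    using assms Suc.prems[of n] by (metis add_diff_cancel_left lessI right_diff_distrib)
  moreover have "X n b - X n a = slope n * (b - a)"
    using Suc by simp
  ultimately show ?case by (simp add: slope_Suc algebra_simps)
qed

text \<open>
  Two surviving parameters with the same label have values of \<open>X (Suc n)\<close> less than \<open>1\<close> apart, and
  \<open>X (Suc n)\<close> expands their distance by the factor \<open>slope (Suc n)\<close>.
\<close>
lemma dist_survivors_le:
  assumes "a \<in> survivors" "b \<in> survivors" "itinerary_sum (Suc n) a = itinerary_sum (Suc n) b"
  shows "dist a b \<le> inverse (\<beta> ^ n)"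
proof -
  have *: "b - a \<le> inverse (\<beta> ^ n)"
    if "a \<le> b" "a \<in> survivors" "b \<in> survivors" "itinerary_sum (Suc n) a = itinerary_sum (Suc n) b"
    for a b
  proof -
    note fl = floor_X_eq_of_itinerary_sum_eq[OF that(1) that(4)]
    have "slope (Suc n) * (b - a) = X (Suc n) b - X (Suc n) a"
      using X_increment_survivors[OF that(2,3), of "Suc n"] fl by (simp del: lifted_orbit.simps)
    also have "\<dots> \<le> 1"
      using fl[of "Suc n"] by linarith
    finally have "slope (Suc n) * (b - a) \<le> 1" .
    moreover have "\<beta> ^ n * (b - a) \<le> slope (Suc n) * (b - a)"
      using power_le_slope_Suc that(1) by (intro mult_right_mono) auto
    ultimately show ?thesis using beta_gt_1 by (simp add: field_simps)
  qed
  show ?thesis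
    using *[of a b] *[of b a] assms by (auto simp: dist_real_def abs_if)
qed

text \<open>
  The number of pieces is polynomial times \<open>d ^ n\<close>, and \<open>d ^ n\<close> is beaten by \<open>\<beta> ^ n\<close> to the power \<open>s\<close>
  as soon as \<open>s\<close> exceeds \<open>ln d / ln \<beta>\<close>.
\<close>
lemma cover_vanishes:
  assumes "d < \<beta> powr s"
  shows "(\<lambda>n. real ((n + 2)\<^sup>2 * d ^ Suc n) * inverse (\<beta> ^ n) powr s) \<longlonglongrightarrow> 0"
proof -
  define q where "q = d / \<beta> powr s"
  have q: "0 < q" "q < 1" using assms d_pos beta_gt_1 by (auto simp: q_def)
  have "(\<lambda>n. d * ((real n + 2)\<^sup>2 * q ^ n)) \<longlonglongrightarrow> 0"
    using q by real_asymp
  moreover have "d * ((real n + 2)\<^sup>2 * q ^ n) = real ((n + 2)\<^sup>2 * d ^ Suc n) * inverse (\<beta> ^ n) powr s" for n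
  proof -
    have "(\<beta> ^ n) powr s = (\<beta> powr s) ^ n"
      using beta_gt_1 by (simp add: powr_power powr_powr mult.commute flip: powr_realpow)
    then have "inverse (\<beta> ^ n) powr s = inverse ((\<beta> powr s) ^ n)"
      using beta_gt_1 by (simp add: inverse_powr)
    then show ?thesis by (simp add: q_def divide_inverse power_mult_distrib power_inverse add.commute)
  qed
  ultimately show ?thesis by simp
qed

lemma hausdorff_measure_survivors_eq_0:
  assumes s: "ln d / ln \<beta> < s"
  shows "hausdorff_measure s {\<alpha>\<in>{0..1}. \<alpha> + v \<in> survivors} = 0"
proof (rule hausdorff_measure_eq_0I)
  have "0 \<le> ln d / ln \<beta>" using d_pos beta_gt_1 by simp
  then show "0 < s" using s by linarith
  have "ln d < s * ln \<beta>" using s beta_gt_1 by (simp add: field_simps)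
  then have "exp (ln d) < exp (s * ln \<beta>)" by (rule exp_less_mono)
  then have ds: "d < \<beta> powr s" using d_pos beta_gt_1 by (simp add: powr_def)
  fix \<delta> \<epsilon> :: real
  assume pos: "0 < \<delta>" "0 < \<epsilon>"
  have "(\<lambda>n. inverse (\<beta> ^ n)) \<longlonglongrightarrow> 0"
    using beta_gt_1 by (rule LIMSEQ_inverse_realpow_zero)
  then have "\<forall>\<^sub>F n in sequentially. inverse (\<beta> ^ n) < \<delta>"
    using pos(1) by (rule order_tendstoD)
  moreover have "\<forall>\<^sub>F n in sequentially. real ((n + 2)\<^sup>2 * d ^ Suc n) * inverse (\<beta> ^ n) powr s < \<epsilon>"
    using cover_vanishes[OF ds] pos(2) by (rule order_tendstoD)
  ultimately have "\<forall>\<^sub>F n in sequentially. inverse (\<beta> ^ n) < \<delta> \<and>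
      real ((n + 2)\<^sup>2 * d ^ Suc n) * inverse (\<beta> ^ n) powr s < \<epsilon>"
    by (rule eventually_conj)
  then obtain n where n: "inverse (\<beta> ^ n) < \<delta>"
      "real ((n + 2)\<^sup>2 * d ^ Suc n) * inverse (\<beta> ^ n) powr s < \<epsilon>"
    by (auto simp: eventually_sequentially)
  define I where "I = itinerary_sum (Suc n)"
  define N where "N = (n + 2)\<^sup>2 * d ^ Suc n"
  define U where "U i = {\<alpha>\<in>{0..1}. \<alpha> + v \<in> survivors \<and> I (\<alpha> + v) = I v + int i}" for i :: nat
  have "{\<alpha>\<in>{0..1}. \<alpha> + v \<in> survivors} \<subseteq> (\<Union>i<N. U i)"
  proof safe
    fix \<alpha> :: real
    assume \<alpha>: "\<alpha> \<in> {0..1}" "\<alpha> + v \<in> survivors"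
    have "I v \<le> I (\<alpha> + v)" "I (\<alpha> + v) \<le> I (v + 1)"
      unfolding I_def using \<alpha>(1) by (auto intro!: itinerary_sum_mono)
    moreover have "I (v + 1) < I v + int N"
    proof -
      define S where "S = (\<Sum>j\<le>Suc n. \<Sum>i<j. d ^ i)"
      have "S + 1 \<le> N" using itinerary_count_le[of "Suc n"] by (simp only: S_def N_def Suc_eq_plus1 add.assoc one_add_one)
      moreover have "I (v + 1) = I v + int S" unfolding I_def S_def by (rule itinerary_sum_add_1)
      ultimately show ?thesis by linarith
    qed
    ultimately have "I (\<alpha> + v) = I v + int (nat (I (\<alpha> + v) - I v))"
      and "nat (I (\<alpha> + v) - I v) < N" by linarith+
    then have "\<alpha> \<in> U (nat (I (\<alpha> + v) - I v))" "nat (I (\<alpha> + v) - I v) \<in> {..<N}"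
      using \<alpha> by (simp_all only: U_def mem_Collect_eq lessThan_iff simp_thms)
    then show "\<alpha> \<in> (\<Union>i<N. U i)" by (rule UN_I[rotated])
  qed
  moreover have "bounded (U i)" for i
    by (rule bounded_subset[of "{0..1}"]) (auto simp: U_def)
  moreover have "diameter (U i) \<le> inverse (\<beta> ^ n)" for i
  proof (rule diameter_le)
    show "U i \<noteq> {} \<or> 0 \<le> inverse (\<beta> ^ n)" using beta_gt_1 by simp
    fix x y assume "x \<in> U i" "y \<in> U i"
    then show "norm (x - y) \<le> inverse (\<beta> ^ n)"
      using dist_survivors_le[of "x + v" "y + v" n] by (auto simp: U_def I_def dist_norm)
  qed
  ultimately show "\<exists>(N :: nat) (U :: nat \<Rightarrow> real set) r. r \<le> \<delta> \<and>
      {\<alpha>\<in>{0..1}. \<alpha> + v \<in> survivors} \<subseteq> (\<Union>i<N. U i) \<and>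
      (\<forall>i<N. bounded (U i) \<and> diameter (U i) \<le> r) \<and> N * r powr s \<le> \<epsilon>"
    using n by (intro exI[of _ N] exI[of _ U] exI[of _ "inverse (\<beta> ^ n)"] conjI)
      (auto simp: N_def simp del: power_Suc)
qed

end

section \<open>The rotation number as a Cantor function\<close>

text \<open>
  For \<open>d = 1\<close> the lower bound on the dimension is trivial, and \<open>X n a / d ^ n\<close> need not converge.
\<close>
locale branching_slope = wide_slope +
  assumes two_branches: "2 \<le> d"
begin

text \<open>
  The semiconjugacy of the collapsed map to \<open>x \<mapsto> d * x\<close>, evaluated at the orbit of \<open>0\<close>; for \<open>d = 1\<close> the
  analogous quantity would be the rotation number, whence the name.
\<close>
definition rotation :: "real \<Rightarrow> real" where
  "rotation a = lim (\<lambda>n. X n a / real d ^ n)"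

text \<open>
  One step changes the quotient by at most \<open>(d + \<bar>a\<bar>) / d ^ Suc k\<close>, which is at most \<open>d + \<bar>a\<bar>\<close> times
  \<open>1 / d ^ k - 1 / d ^ Suc k\<close> because \<open>d \<ge> 2\<close>; in this form the bounds telescope.
\<close>
lemma X_scaled_increment:
  "\<bar>X (m + n) a / real d ^ (m + n) - X n a / real d ^ n\<bar> \<le> (real d + \<bar>a\<bar>) * (1 / real d ^ n - 1 / real d ^ (m + n))"
proof (induction m)
  case (Suc m)
  define k where "k = m + n"
  define D where "D = real d ^ k"
  have D: "0 < D" "2 \<le> real d" using two_branches by (auto simp: D_def)
  have "\<bar>X (Suc k) a - d * X k a\<bar> \<le> d + \<bar>a\<bar>"
    using g_approx[of "X k a"] by simp
  moreover have "X (Suc k) a / real d ^ Suc k - X k a / real d ^ k = (X (Suc k) a - d * X k a) / (d * D)"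
    using D by (simp add: D_def field_simps del: lifted_orbit.simps)
  ultimately have "\<bar>X (Suc k) a / real d ^ Suc k - X k a / real d ^ k\<bar> \<le> (real d + \<bar>a\<bar>) * (1 / (d * D))"
    using D by (simp add: abs_divide divide_right_mono del: lifted_orbit.simps)
  also have "\<dots> \<le> (real d + \<bar>a\<bar>) * (1 / real d ^ k - 1 / real d ^ Suc k)"
    using D by (intro mult_left_mono) (auto simp: D_def[symmetric] field_simps)
  finally show ?case
    using Suc by (simp add: k_def algebra_simps del: lifted_orbit.simps power_Suc)
qed simp

lemma rotation_limit: "(\<lambda>n. X n a / real d ^ n) \<longlonglongrightarrow> rotation a"
proof -
  have "Cauchy (\<lambda>n. X n a / real d ^ n)"
  proof (rule metric_CauchyI)
    fix e :: real assume e: "0 < e"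
    have "(\<lambda>n. (real d + \<bar>a\<bar>) * (1 / real d ^ n)) \<longlonglongrightarrow> 0"
      using two_branches by real_asymp
    then have "\<forall>\<^sub>F n in sequentially. (real d + \<bar>a\<bar>) * (1 / real d ^ n) < e / 2"
      using e by (intro order_tendstoD) auto
    then obtain M where M: "(real d + \<bar>a\<bar>) * (1 / real d ^ M) < e / 2"
      by (auto simp: eventually_sequentially)
    have "dist (X n a / real d ^ n) (X M a / real d ^ M) < e / 2" if "M \<le> n" for n
    proof -
      have "dist (X n a / real d ^ n) (X M a / real d ^ M) \<le> (real d + \<bar>a\<bar>) * (1 / real d ^ M - 1 / real d ^ n)"
        using X_scaled_increment[of "n - M" M a] that by (simp add: dist_real_def)
      also have "\<dots> \<le> (real d + \<bar>a\<bar>) * (1 / real d ^ M)" by (intro mult_left_mono) auto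
      finally show ?thesis using M by linarith
    qed
    then have "dist (X m a / real d ^ m) (X n a / real d ^ n) < e" if "M \<le> m" "M \<le> n" for m n
      using that dist_triangle_half_l by blast
    then show "\<exists>M. \<forall>m\<ge>M. \<forall>n\<ge>M. dist (X m a / real d ^ m) (X n a / real d ^ n) < e" by blast
  qed
  then show ?thesis
    unfolding rotation_def by (intro convergent_LIMSEQ_iff[THEN iffD1] Cauchy_convergent)
qed

text \<open>
  The collapsed lift stays within \<open>d\<close> of multiplication by \<open>d\<close>, so the errors committed after time
  \<open>n\<close> form a geometric series.
\<close>
lemma rotation_approx: "\<bar>rotation a - X n a / real d ^ n\<bar> \<le> (real d + \<bar>a\<bar>) / real d ^ n"
proof (rule Lim_bounded)
  show "(\<lambda>m. \<bar>X m a / real d ^ m - X n a / real d ^ n\<bar>) \<longlonglongrightarrow> \<bar>rotation a - X n a / real d ^ n\<bar>"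
    by (intro tendsto_intros rotation_limit)
  show "\<forall>m\<ge>n. \<bar>X m a / real d ^ m - X n a / real d ^ n\<bar> \<le> (real d + \<bar>a\<bar>) / real d ^ n"
  proof safe
    fix m assume "n \<le> m"
    then have "\<bar>X m a / real d ^ m - X n a / real d ^ n\<bar> \<le> (real d + \<bar>a\<bar>) * (1 / real d ^ n - 1 / real d ^ m)"
      using X_scaled_increment[of "m - n" n a] by simp
    also have "\<dots> \<le> (real d + \<bar>a\<bar>) * (1 / real d ^ n)" by (intro mult_left_mono) auto
    finally show "\<bar>X m a / real d ^ m - X n a / real d ^ n\<bar> \<le> (real d + \<bar>a\<bar>) / real d ^ n" by simp
  qed
qed

text \<open>
  Up to time \<open>n\<close> the Lipschitz bound \<open>\<beta> ^ n / (\<beta> - 1)\<close> is used, afterwards the approximation by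
  \<open>X n / d ^ n\<close>. The best \<open>n\<close> is the one where \<open>\<beta> ^ n\<close> is comparable with \<open>1 / dist a b\<close>: then
  \<open>1 / d ^ n\<close> is comparable with \<open>dist a b\<close> to the power \<open>ln d / ln \<beta>\<close>.
\<close>
lemma rotation_holder:
  assumes ab: "\<bar>a\<bar> \<le> R" "\<bar>b\<bar> \<le> R" "dist a b \<le> 1"
  shows "dist (rotation a) (rotation b) \<le> (2 * (real d + R) + 1 / (\<beta> - 1)) * d * dist a b powr (ln (real d) / ln \<beta>)"
proof (cases "a = b")
  case False
  define h where "h = dist a b"
  have h: "0 < h" "h \<le> 1" using False ab(3) by (auto simp: h_def)
  define n where "n = nat \<lfloor>log \<beta> (1 / h)\<rfloor>"
  have "0 \<le> log \<beta> (1 / h)" using h beta_gt_1 by simp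
  then have n: "n \<le> log \<beta> (1 / h)" "log \<beta> (1 / h) < n + 1"
    unfolding n_def by linarith+
  have n1: "\<beta> ^ n * h \<le> 1"
  proof -
    have "\<beta> powr n \<le> 1 / h" using n(1) h beta_gt_1 by (simp add: le_log_iff)
    then show ?thesis using h beta_gt_1 by (simp add: powr_realpow field_simps)
  qed
  have n2: "1 / real d ^ n \<le> d * h powr (ln (real d) / ln \<beta>)"
  proof -
    have "1 / h < \<beta> powr (n + 1)" using n(2) h beta_gt_1 by (simp add: log_less_iff)
    then have "1 / (\<beta> powr (n + 1)) \<le> h"
      using h beta_gt_1 by (simp add: field_simps)
    then have "\<beta> powr - real (n + 1) \<le> h" by (simp only: powr_minus_divide)
    then have "(\<beta> powr - real (n + 1)) powr (ln (real d) / ln \<beta>) \<le> h powr (ln (real d) / ln \<beta>)"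
      using d_pos beta_gt_1 by (intro powr_mono2) auto
    also have "(\<beta> powr - real (n + 1)) powr (ln (real d) / ln \<beta>) = d powr - real (n + 1)"
      using d_pos beta_gt_1 by (simp add: powr_def)
    also have "\<dots> = 1 / (d * d ^ n)"
      using d_pos powr_realpow[of d "Suc n"] unfolding powr_minus_divide by simp
    finally show ?thesis using d_pos by (simp add: field_simps)
  qed
  have "\<bar>X n a - X n b\<bar> \<le> slope n * h"
    using X_increment[of a b n] X_increment[of b a n]
    by (cases "a \<le> b") (auto simp: h_def dist_real_def)
  also have "\<dots> \<le> (\<beta> ^ n / (\<beta> - 1)) * h"
    using h slope_le by (intro mult_right_mono) auto
  also have "\<dots> \<le> 1 / (\<beta> - 1)"
    using n1 beta_gt_1 by (simp add: divide_right_mono)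
  finally have "\<bar>X n a - X n b\<bar> / real d ^ n \<le> 1 / (\<beta> - 1) / real d ^ n"
    by (rule divide_right_mono) simp
  then have "\<bar>X n a / real d ^ n - X n b / real d ^ n\<bar> \<le> 1 / (\<beta> - 1) / real d ^ n"
    by (simp add: abs_divide flip: diff_divide_distrib)
  moreover have "(real d + \<bar>a\<bar>) / real d ^ n \<le> (real d + R) / real d ^ n" "(real d + \<bar>b\<bar>) / real d ^ n \<le> (real d + R) / real d ^ n"
    using ab by (auto intro!: divide_right_mono)
  ultimately have "dist (rotation a) (rotation b)
      \<le> (real d + R) / real d ^ n + (real d + R) / real d ^ n + 1 / (\<beta> - 1) / real d ^ n"
    using rotation_approx[of a n] rotation_approx[of b n] unfolding dist_real_def by linarith
  also have "\<dots> = (2 * (real d + R) + 1 / (\<beta> - 1)) * (1 / real d ^ n)"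
    by (simp add: add_divide_distrib)
  also have "\<dots> \<le> (2 * (real d + R) + 1 / (\<beta> - 1)) * (d * h powr (ln (real d) / ln \<beta>))"
    using n2 ab beta_gt_1 by (intro mult_left_mono) auto
  finally show ?thesis by (simp add: h_def mult.assoc)
qed simp

lemma continuous_on_rotation: "continuous_on UNIV rotation"
proof (rule continuous_at_imp_continuous_on, safe)
  fix a :: real
  define C where "C = (2 * (real d + (\<bar>a\<bar> + 1)) + 1 / (\<beta> - 1)) * d"
  have ev: "\<forall>\<^sub>F b in at a. dist b a < 1" by (auto simp: eventually_at intro: exI[of _ 1])
  have "((\<lambda>b. dist (rotation b) (rotation a)) \<longlongrightarrow> 0) (at a)"
  proof (rule tendsto_sandwich)
    show "\<forall>\<^sub>F b in at a. 0 \<le> dist (rotation b) (rotation a)" by simp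
    show "((\<lambda>_. 0) \<longlongrightarrow> 0) (at a)" by simp
    show "\<forall>\<^sub>F b in at a. dist (rotation b) (rotation a) \<le> C * dist b a powr (ln (real d) / ln \<beta>)"
      using ev unfolding C_def
    proof eventually_elim
      case (elim b)
      then have "\<bar>b\<bar> \<le> \<bar>a\<bar> + 1" by (simp add: dist_real_def)
      then show ?case using elim by (intro rotation_holder) auto
    qed
    have "0 < ln (real d) / ln \<beta>" using two_branches beta_gt_1 by simp
    moreover have "((\<lambda>b. dist b a) \<longlongrightarrow> 0) (at a)"
      using tendsto_dist[OF tendsto_ident_at tendsto_const, of a a UNIV] by simp
    ultimately have "((\<lambda>b. dist b a powr (ln (real d) / ln \<beta>)) \<longlongrightarrow> 0) (at a)"
      by (intro tendsto_zero_powrI[where b = "ln d / ln \<beta>"] tendsto_const) auto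
    then show "((\<lambda>b. C * dist b a powr (ln (real d) / ln \<beta>)) \<longlongrightarrow> 0) (at a)"
      by (rule tendsto_mult_right_zero)
  qed
  then show "isCont rotation a" unfolding isCont_def by (rule tendsto_dist_iff[THEN iffD2])
qed

lemma rotation_add_1: "rotation a + 1 / d \<le> rotation (a + 1)"
proof (rule LIMSEQ_le)
  show "(\<lambda>n. X n a / real d ^ n + 1 / real d) \<longlonglongrightarrow> rotation a + 1 / d"
    by (intro tendsto_intros rotation_limit)
  show "(\<lambda>n. X n (a + 1) / real d ^ n) \<longlonglongrightarrow> rotation (a + 1)" by (rule rotation_limit)
  have "X (Suc n) a / real d ^ Suc n + 1 / d \<le> X (Suc n) (a + 1) / real d ^ Suc n" for n
  proof -
    have "d ^ n \<le> (\<Sum>j<Suc n. d ^ j)" by simp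
    then have "real d ^ n \<le> real (\<Sum>j<Suc n. d ^ j)" by (metis of_nat_le_iff of_nat_power)
    then have "X (Suc n) a + real d ^ n \<le> X (Suc n) (a + 1)"
      unfolding X_add_1 by simp
    then have "(X (Suc n) a + real d ^ n) / real d ^ Suc n \<le> X (Suc n) (a + 1) / real d ^ Suc n"
      by (intro divide_right_mono) auto
    then show ?thesis using d_pos by (simp add: add_divide_distrib del: lifted_orbit.simps)
  qed
  then show "\<exists>N. \<forall>n\<ge>N. X n a / real d ^ n + 1 / d \<le> X n (a + 1) / real d ^ n"
    by (metis Suc_le_D)
qed

text \<open>
  If \<open>X n a\<close> lies in the hole, its image is frozen at a multiple of \<open>d\<close>, so from time \<open>n\<close> on the orbit
  repeats modulo integers: \<open>X (j + n) a = X j a + d ^ j * M\<close>. In the limit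
  \<open>d ^ n * rotation a = rotation a + M\<close>.
\<close>
lemma rotation_rational_if_not_survivor:
  assumes "a \<notin> survivors"
  shows "\<exists>n (M :: int). rotation a = M / (real d ^ n - 1)"
proof -
  obtain n where n: "d / \<beta> \<le> frac (X n a)"
    using assms by (auto simp: survivors_def not_less)
  have "n \<noteq> 0" using n d_pos beta_gt_1 by (cases n) (auto simp: field_simps)
  define M where "M = \<lfloor>X n a\<rfloor> + 1"
  have "d \<le> \<beta> * frac (X n a)" using n beta_gt_1 by (simp add: field_simps)
  then have "g (X n a) = d * of_int M" by (simp add: collapsed_lift_def M_def algebra_simps)
  have shift: "X (Suc j + n) a = X (Suc j) a + of_int (int d ^ Suc j * M)" for j
  proof (induction j)
    case 0
    have "g 0 = 0" by (simp add: collapsed_lift_def)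
    then show ?case using \<open>g (X n a) = d * of_int M\<close> by simp
  next
    case (Suc j)
    have "g (X (Suc j + n) a) = g (X (Suc j) a) + d * of_int (int d ^ Suc j * M)"
      using g_add_int[of "X (Suc j) a" "int d ^ Suc j * M"] Suc
      by (simp del: lifted_orbit.simps)
    moreover have "X (Suc (Suc j) + n) a = g (X (Suc j + n) a) + a"
      "X (Suc (Suc j)) a = g (X (Suc j) a) + a" by simp_all
    ultimately show ?case by (simp del: lifted_orbit.simps add: algebra_simps)
  qed
  have "(\<lambda>j. X (Suc j) a / real d ^ Suc j + M) \<longlonglongrightarrow> rotation a + M"
    by (intro tendsto_intros LIMSEQ_Suc rotation_limit)
  moreover have "X (Suc j) a / real d ^ Suc j + M = real d ^ n * (X (Suc j + n) a / real d ^ (Suc j + n))" for j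
    unfolding shift using d_pos by (simp add: power_add field_simps)
  moreover have "(\<lambda>j. real d ^ n * (X (Suc j + n) a / real d ^ (Suc j + n))) \<longlonglongrightarrow> real d ^ n * rotation a"
    by (intro tendsto_intros LIMSEQ_Suc[of "\<lambda>j. X (j + n) a / real d ^ (j + n)"] LIMSEQ_ignore_initial_segment rotation_limit)
  ultimately have "real d ^ n * rotation a = rotation a + M"
    using LIMSEQ_unique by auto
  moreover have "1 < real d ^ n" using two_branches \<open>n \<noteq> 0\<close> by (intro one_less_power) auto
  ultimately have "rotation a = M / (real d ^ n - 1)" by (simp add: field_simps)
  then show ?thesis by blast
qed

text \<open>
  Over a parameter interval of length \<open>1\<close> the continuous function \<open>rotation\<close> covers an interval of positive
  length, and the parameters that do not survive contribute only rational values to it.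
\<close>
lemma hausdorff_measure_survivors_neq_0:
  assumes s: "0 \<le> s" "s < ln (real d) / ln \<beta>"
  shows "hausdorff_measure s {\<alpha>\<in>{0..1}. \<alpha> + v \<in> survivors} \<noteq> 0"
proof (rule hausdorff_measure_neq_0_of_holder)
  let ?A = "{\<alpha>\<in>{0..1}. \<alpha> + v \<in> survivors}"
  let ?f = "\<lambda>\<alpha>. rotation (\<alpha> + v)"
  define C where "C = (2 * (real d + (1 + \<bar>v\<bar>)) + 1 / (\<beta> - 1)) * d"
  \<comment> \<open>The values that \<open>rotation_rational_if_not_survivor\<close> allows outside the surviving set.\<close>
  define K where "K = (\<Union>n. range (\<lambda>M :: int. M / (real d ^ n - 1)))"
  show "dist (?f x) (?f y) \<le> C * dist x y powr (ln (real d) / ln \<beta>)"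
    if "x \<in> ?A" "y \<in> ?A" "dist x y \<le> 1" for x y
    using rotation_holder[of "x + v" "1 + \<bar>v\<bar>" "y + v"] that by (auto simp: C_def)
  show "0 \<le> C" using beta_gt_1 by (simp add: C_def)
  show "countable K" unfolding K_def by (intro countable_UN countable_image) auto
  show "rotation v < rotation (v + 1)"
    using rotation_add_1[of v] d_pos by (smt (verit) divide_pos_pos of_nat_0_less_iff less_le_trans zero_less_one)
  show "{rotation v..rotation (v + 1)} \<subseteq> ?f ` ?A \<union> K"
  proof safe
    fix t assume t: "t \<in> {rotation v..rotation (v + 1)}" "t \<notin> K"
    have "\<exists>\<alpha>\<ge>0. \<alpha> \<le> 1 \<and> ?f \<alpha> = t"
      using t(1) continuous_on_rotation
      by (intro IVT') (auto simp: add.commute intro!: continuous_on_compose2[of UNIV rotation] continuous_intros)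
    then obtain \<alpha> where \<alpha>: "\<alpha> \<in> {0..1}" "?f \<alpha> = t" by auto
    have "\<alpha> + v \<in> survivors"
      using rotation_rational_if_not_survivor[of "\<alpha> + v"] \<alpha>(2) t(2) by (auto simp: K_def)
    then show "t \<in> ?f ` ?A" using \<alpha> by auto
  qed
qed (use s in auto)

end

text \<open>
  For \<open>d = 1\<close> there is no exponent \<open>s\<close> with \<open>0 \<le> s < ln d / ln \<beta>\<close>, so only \<open>d \<ge> 2\<close> needs a lower
  bound on the measure.
\<close>
theorem (in wide_slope) hausdorff_dim_survivors:
  "hausdorff_dim {\<alpha>\<in>{0..1}. \<alpha> + v \<in> survivors} = ereal (ln (real d) / ln \<beta>)"
proof (rule antisym)
  show "hausdorff_dim {\<alpha>\<in>{0..1}. \<alpha> + v \<in> survivors} \<le> ereal (ln (real d) / ln \<beta>)"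
    using hausdorff_measure_survivors_eq_0 d_pos beta_gt_1 by (intro hausdorff_dim_leI) auto
  show "ereal (ln (real d) / ln \<beta>) \<le> hausdorff_dim {\<alpha>\<in>{0..1}. \<alpha> + v \<in> survivors}"
  proof (rule hausdorff_dim_geI)
    fix s :: real assume s: "0 \<le> s" "s < ln (real d) / ln \<beta>"
    then have "d \<noteq> 1" by auto
    then interpret branching_slope using d_pos by unfold_locales auto
    show "hausdorff_measure s {\<alpha>\<in>{0..1}. \<alpha> + v \<in> survivors} \<noteq> 0"
      using s by (rule hausdorff_measure_survivors_neq_0)
  qed
qed

section \<open>Matching as an exit from the surviving set\<close>

lemma frac_eqI:
  assumes "x - y \<in> \<int>"
  shows "frac x = frac y"
proof -
  obtain m where "x - y = of_int m" using assms by (rule Ints_cases)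
  then have "x = y + of_int m" by simp
  then show ?thesis by (simp add: frac_def)
qed

text \<open>
  Collapsing changes the map only on the hole, so the two orbits agree up to and including the first
  visit to the hole.
\<close>
lemma (in wide_slope) orbit_plus_eq_frac_X:
  assumes "\<And>j. j < n \<Longrightarrow> frac (X j a) < d / \<beta>"
  shows "orbit_plus \<beta> a n = frac (X n a)"
  using assms
proof (induction n)
  case 0
  show ?case by (simp add: orbit_plus_def)
next
  case (Suc n)
  have "\<beta> * frac (X n a) < d" using Suc.prems[of n] beta_gt_1 by (simp add: field_simps)
  then have "X (Suc n) a = d * of_int \<lfloor>X n a\<rfloor> + (\<beta> * frac (X n a) + a)"
    by (simp add: collapsed_lift_def)
  then have "frac (X (Suc n) a) = frac (\<beta> * frac (X n a) + a)"
    by (intro frac_eqI) simp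
  then show ?case using Suc by (simp add: orbit_plus_def T_def)
qed

lemma (in wide_slope) survivors_iff_orbit_plus:
  "a \<in> survivors \<longleftrightarrow> (\<forall>n\<ge>1. orbit_plus \<beta> a n < d / \<beta>)"
proof
  assume a: "a \<in> survivors"
  then have "orbit_plus \<beta> a n = frac (X n a)" for n
    by (intro orbit_plus_eq_frac_X) (auto simp: survivors_def)
  then show "\<forall>n\<ge>1. orbit_plus \<beta> a n < d / \<beta>"
    using a by (simp add: survivors_def)
next
  assume orb: "\<forall>n\<ge>1. orbit_plus \<beta> a n < d / \<beta>"
  have "frac (X n a) < d / \<beta>" for n
  proof (induction n rule: less_induct)
    case (less n)
    show ?case
    proof (cases n)
      case 0
      then show ?thesis using d_pos beta_gt_1 by simp
    next
      case (Suc m)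
      have "orbit_plus \<beta> a n = frac (X n a)" using less by (rule orbit_plus_eq_frac_X)
      moreover have "orbit_plus \<beta> a n < d / \<beta>" using orb Suc by simp
      ultimately show ?thesis by simp
    qed
  qed
  then show "a \<in> survivors" by (simp add: survivors_def)
qed

lemma orbit_plus_Suc: "orbit_plus \<beta> \<alpha> (Suc n) = T \<beta> \<alpha> (orbit_plus \<beta> \<alpha> n)"
  by (simp add: orbit_plus_def)

lemma orbit_minus_Suc:
  assumes "1 \<le> n"
  shows "orbit_minus \<beta> \<alpha> (Suc n) = T \<beta> \<alpha> (orbit_minus \<beta> \<alpha> n)"
proof -
  have "n = Suc (n - 1)" using assms by simp
  then show ?thesis unfolding orbit_minus_def by (metis comp_apply diff_Suc_1 funpow.simps(2))
qed

lemma T_in_unit: "0 \<le> T \<beta> \<alpha> x" "T \<beta> \<alpha> x < 1"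
  by (simp_all add: T_def frac_lt_1)

lemma orbit_plus_in_unit: "0 \<le> orbit_plus \<beta> \<alpha> n" "orbit_plus \<beta> \<alpha> n < 1"
  unfolding orbit_plus_def by (cases n; simp add: T_in_unit)+

lemma orbit_minus_in_unit: "0 \<le> orbit_minus \<beta> \<alpha> n" "orbit_minus \<beta> \<alpha> n < 1"
  unfolding orbit_minus_def by (cases "n - 1"; simp add: T_in_unit frac_lt_1)+

text \<open>
  Here \<open>\<kappa>\<close> is the absolute value of the conjugate of \<open>\<beta>\<close>, so that \<open>\<beta> * \<kappa>\<close> is the absolute value of the
  norm. The shift \<open>v\<close> records the sign of the conjugate: the trace is \<open>\<beta> + \<kappa>\<close> if the conjugate is positive
  and \<open>\<beta> - \<kappa>\<close> if it is negative.
\<close>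
locale conjugate_gap =
  fixes \<beta> \<kappa> v :: real
  assumes gap: "0 < \<kappa>" "\<kappa> < 1"
    and norm_int: "\<beta> * \<kappa> \<in> \<int>"
    and trace_int: "v = 0 \<and> \<beta> + \<kappa> \<in> \<int> \<or> v = \<kappa> \<and> \<beta> - \<kappa> \<in> \<int>"
begin

lemma frac_diff_gap:
  assumes "0 \<le> z" "z < 1"
  shows "frac (z - \<kappa>) = (if z < \<kappa> then z - \<kappa> + 1 else z - \<kappa>)"
  using assms gap by (auto simp: frac_unique_iff)

text \<open>
  A pair \<open>z\<close>, \<open>z - \<kappa> + 1\<close> is mapped to a pair of the same kind, since \<open>\<beta> * (1 - \<kappa>)\<close> is congruent to
  \<open>\<beta>\<close> modulo \<open>1\<close>, hence to \<open>-\<kappa>\<close> for a positive conjugate and to \<open>\<kappa>\<close> for a negative one. In the second case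
  the two points exchange their roles, which is why the pairs are unordered: the image of \<open>z\<close> is the one to
  which \<open>\<kappa>\<close> has to be added, and adding \<open>\<kappa>\<close> to it amounts to adding \<open>\<kappa>\<close> to the parameter.
\<close>
lemma T_pair:
  assumes z: "0 \<le> z" "z < \<kappa>"
  shows "T \<beta> \<alpha> ` {z, frac (z - \<kappa>)} = {T \<beta> (\<alpha> + v) z, frac (T \<beta> (\<alpha> + v) z - \<kappa>)}"
proof -
  have q: "frac (z - \<kappa>) = z - \<kappa> + 1" using z gap by (simp add: frac_diff_gap)
  have frac_frac: "frac (frac x - \<kappa>) = frac (x - \<kappa>)" for x
    by (rule frac_eqI) (simp add: frac_def)
  from trace_int show ?thesis
  proof
    assume v: "v = 0 \<and> \<beta> + \<kappa> \<in> \<int>"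
    have "\<beta> * (z - \<kappa> + 1) + \<alpha> - (\<beta> * z + \<alpha> - \<kappa>) = (\<beta> + \<kappa>) - \<beta> * \<kappa>"
      by (simp add: algebra_simps)
    moreover have "(\<beta> + \<kappa>) - \<beta> * \<kappa> \<in> \<int>"
      using v by (intro Ints_diff[OF _ norm_int]) blast
    ultimately have "frac (\<beta> * (z - \<kappa> + 1) + \<alpha>) = frac (\<beta> * z + \<alpha> - \<kappa>)"
      by (intro frac_eqI) (simp only:)
    then show ?thesis using v by (simp add: T_def q frac_frac)
  next
    assume v: "v = \<kappa> \<and> \<beta> - \<kappa> \<in> \<int>"
    have "\<beta> * (z - \<kappa> + 1) + \<alpha> - (\<beta> * z + (\<alpha> + \<kappa>)) = (\<beta> - \<kappa>) - \<beta> * \<kappa>"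
      by (simp add: algebra_simps)
    moreover have "(\<beta> - \<kappa>) - \<beta> * \<kappa> \<in> \<int>"
      using v by (intro Ints_diff[OF _ norm_int]) blast
    ultimately have "frac (\<beta> * (z - \<kappa> + 1) + \<alpha>) = frac (\<beta> * z + (\<alpha> + \<kappa>))"
      by (intro frac_eqI) (simp only:)
    then show ?thesis using v by (simp add: T_def q frac_frac insert_commute)
  qed
qed

lemma T_pair_merge:
  assumes "\<kappa> \<le> z" "z < 1"
  shows "T \<beta> \<alpha> (frac (z - \<kappa>)) = T \<beta> \<alpha> z"
proof -
  have "\<beta> * (z - \<kappa>) + \<alpha> - (\<beta> * z + \<alpha>) = - (\<beta> * \<kappa>)" by (simp add: algebra_simps)
  then have "frac (\<beta> * (z - \<kappa>) + \<alpha>) = frac (\<beta> * z + \<alpha>)"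
    using norm_int by (intro frac_eqI) simp
  then show ?thesis using assms gap by (simp add: T_def frac_diff_gap)
qed

text \<open>
  The circle points \<open>0\<^sup>+\<close> and \<open>0\<^sup>-\<close> behave like the pair \<open>0\<close>, \<open>1\<close>, whose images differ by \<open>\<beta>\<close>, and
  \<open>\<beta>\<close> is congruent to \<open>-\<kappa>\<close> or \<open>\<kappa>\<close>. From then on \<open>T_pair\<close> propagates the relation.
\<close>
lemma orbit_pair:
  assumes "\<And>j. 1 \<le> j \<Longrightarrow> j \<le> n \<Longrightarrow> orbit_plus \<beta> (\<alpha> + v) j < \<kappa>"
  shows "{orbit_plus \<beta> \<alpha> (Suc n), orbit_minus \<beta> \<alpha> (Suc n)} =
    {orbit_plus \<beta> (\<alpha> + v) (Suc n), frac (orbit_plus \<beta> (\<alpha> + v) (Suc n) - \<kappa>)}"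
  using assms
proof (induction n)
  case 0
  have frac_frac: "frac (frac x - \<kappa>) = frac (x - \<kappa>)" for x
    by (rule frac_eqI) (simp add: frac_def)
  from trace_int show ?case
  proof
    assume v: "v = 0 \<and> \<beta> + \<kappa> \<in> \<int>"
    then have "frac (\<beta> + \<alpha>) = frac (\<alpha> - \<kappa>)" by (intro frac_eqI) simp
    then show ?thesis using v by (simp add: orbit_plus_def orbit_minus_def T_def frac_frac)
  next
    assume v: "v = \<kappa> \<and> \<beta> - \<kappa> \<in> \<int>"
    then have "frac (\<beta> + \<alpha>) = frac (\<alpha> + \<kappa>)" by (intro frac_eqI) simp
    then show ?thesis
      using v by (simp add: orbit_plus_def orbit_minus_def T_def frac_frac insert_commute)
  qed
next
  case (Suc n)
  let ?z = "orbit_plus \<beta> (\<alpha> + v) (Suc n)"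
  have "T \<beta> \<alpha> ` {orbit_plus \<beta> \<alpha> (Suc n), orbit_minus \<beta> \<alpha> (Suc n)} = T \<beta> \<alpha> ` {?z, frac (?z - \<kappa>)}"
    using Suc by simp
  also have "\<dots> = {T \<beta> (\<alpha> + v) ?z, frac (T \<beta> (\<alpha> + v) ?z - \<kappa>)}"
    using Suc.prems orbit_plus_in_unit by (intro T_pair) auto
  finally show ?case by (simp add: orbit_plus_Suc orbit_minus_Suc)
qed

text \<open>
  Before the exit the two points of the pair are distinct, since \<open>0 < \<kappa> < 1\<close>; one step after it they coincide.
\<close>
theorem matching_iff_orbit_plus:
  "matching \<beta> \<alpha> \<longleftrightarrow> (\<exists>n\<ge>1. \<kappa> \<le> orbit_plus \<beta> (\<alpha> + v) n)"
proof
  assume "\<exists>n\<ge>1. \<kappa> \<le> orbit_plus \<beta> (\<alpha> + v) n"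
  then obtain n where n: "\<kappa> \<le> orbit_plus \<beta> (\<alpha> + v) (Suc n)"
    and least: "\<And>j. 1 \<le> j \<Longrightarrow> j \<le> n \<Longrightarrow> orbit_plus \<beta> (\<alpha> + v) j < \<kappa>"
    using exists_least_iff[of "\<lambda>n. 1 \<le> n \<and> \<kappa> \<le> orbit_plus \<beta> (\<alpha> + v) n"]
    by (metis Suc_le_D less_Suc_eq_le not_le One_nat_def)
  let ?z = "orbit_plus \<beta> (\<alpha> + v) (Suc n)"
  have "T \<beta> \<alpha> ` {orbit_plus \<beta> \<alpha> (Suc n), orbit_minus \<beta> \<alpha> (Suc n)} = T \<beta> \<alpha> ` {?z, frac (?z - \<kappa>)}"
    using orbit_pair[OF least] by simp
  also have "\<dots> = {T \<beta> \<alpha> ?z}"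
    using T_pair_merge[of ?z \<alpha>] n orbit_plus_in_unit by simp
  finally have "orbit_plus \<beta> \<alpha> (Suc (Suc n)) = orbit_minus \<beta> \<alpha> (Suc (Suc n))"
    by (auto simp: orbit_plus_Suc[of _ _ "Suc n"] orbit_minus_Suc)
  then show "matching \<beta> \<alpha>" by (auto simp: matching_def)
next
  assume "matching \<beta> \<alpha>"
  then obtain n where n: "orbit_plus \<beta> \<alpha> (Suc n) = orbit_minus \<beta> \<alpha> (Suc n)"
    by (metis matching_def Suc_le_D One_nat_def)
  show "\<exists>n\<ge>1. \<kappa> \<le> orbit_plus \<beta> (\<alpha> + v) n"
  proof (rule ccontr)
    let ?z = "orbit_plus \<beta> (\<alpha> + v) (Suc n)"
    assume "\<not> (\<exists>n\<ge>1. \<kappa> \<le> orbit_plus \<beta> (\<alpha> + v) n)"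
    then have small: "\<And>j. 1 \<le> j \<Longrightarrow> orbit_plus \<beta> (\<alpha> + v) j < \<kappa>" by auto
    then have pair: "{orbit_plus \<beta> \<alpha> (Suc n), orbit_minus \<beta> \<alpha> (Suc n)} = {?z, frac (?z - \<kappa>)}"
      by (intro orbit_pair)
    have "?z \<in> {orbit_plus \<beta> \<alpha> (Suc n), orbit_minus \<beta> \<alpha> (Suc n)}"
      "frac (?z - \<kappa>) \<in> {orbit_plus \<beta> \<alpha> (Suc n), orbit_minus \<beta> \<alpha> (Suc n)}"
      unfolding pair by simp_all
    then have "frac (?z - \<kappa>) = ?z" unfolding n by (simp only: insert_absorb2 singleton_iff)
    moreover have "frac (?z - \<kappa>) = ?z - \<kappa> + 1"
      using small[of "Suc n"] orbit_plus_in_unit[of \<beta> "\<alpha> + v" "Suc n"] by (simp add: frac_diff_gap)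
    ultimately show False using gap by simp
  qed
qed

text \<open>
  Matching occurs at the second step when \<open>\<alpha> + v\<close> is congruent to \<open>\<kappa>\<close>, the left end of the hole.
\<close>
lemma matching_exists: "\<exists>\<alpha>\<in>{0..1}. matching \<beta> \<alpha>"
proof
  show "frac (\<kappa> - v) \<in> {0..1}" by (auto intro: less_imp_le frac_lt_1)
  have "frac (frac (\<kappa> - v) + v) = frac \<kappa>" by (rule frac_eqI) (simp add: frac_def)
  also have "\<dots> = \<kappa>" using gap by (simp add: frac_eq)
  finally have "orbit_plus \<beta> (frac (\<kappa> - v) + v) 1 = \<kappa>" by (simp add: orbit_plus_def T_def)
  then show "matching \<beta> (frac (\<kappa> - v))" unfolding matching_iff_orbit_plus by (metis order_refl)
qed

lemma hausdorff_dim_non_matching_set: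
  assumes "0 < d" "\<beta> * \<kappa> = of_int d" "0 < \<beta>"
  shows "hausdorff_dim (non_matching_set \<beta>) = ereal (ln (of_int d) / ln \<beta>)"
proof -
  have d: "real (nat d) = of_int d" using assms(1) by simp
  have "\<beta> * \<kappa> < \<beta> * 1" using gap assms(3) by (intro mult_strict_left_mono) auto
  then interpret wide_slope \<beta> "nat d"
    using assms by unfold_locales auto
  have lam: "real (nat d) / \<beta> = \<kappa>" using assms by (simp add: field_simps)
  have "non_matching_set \<beta> = {\<alpha>\<in>{0..1}. \<alpha> + v \<in> survivors}"
    unfolding non_matching_set_def matching_iff_orbit_plus survivors_iff_orbit_plus lam
    by (simp only: not_ex not_le de_Morgan_conj imp_conv_disj)
  then show ?thesis using hausdorff_dim_survivors[of v] by (simp add: d)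
qed

end

section \<open>Quadratic Pisot numbers\<close>

lemma map_poly_hom_add:
  fixes h :: "'a::comm_semiring_0 \<Rightarrow> 'b::comm_semiring_0"
  assumes "h 0 = 0" "\<And>a b. h (a + b) = h a + h b"
  shows "map_poly h (p + q) = map_poly h p + map_poly h q"
  using assms by (intro poly_eqI) (simp add: coeff_map_poly)

lemma map_poly_hom_mult:
  fixes h :: "'a::comm_semiring_0 \<Rightarrow> 'b::comm_semiring_0"
  assumes "h 0 = 0" "\<And>a b. h (a + b) = h a + h b" "\<And>a b. h (a * b) = h a * h b"
  shows "map_poly h (p * q) = map_poly h p * map_poly h q"
proof (rule poly_eqI)
  fix n
  have "h (sum f A) = (\<Sum>i\<in>A. h (f i))" for f :: "nat \<Rightarrow> 'a" and A
    using sum_comp_morphism[of h f A, OF assms(1,2)] by (simp add: o_def)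
  then have "h (\<Sum>i\<le>n. coeff p i * coeff q (n - i)) = (\<Sum>i\<le>n. h (coeff p i) * h (coeff q (n - i)))"
    by (simp only: assms(3))
  then show "coeff (map_poly h (p * q)) n = coeff (map_poly h p * map_poly h q) n"
    using assms(1) by (simp add: coeff_map_poly coeff_mult)
qed

lemma poly_map_poly_of_rat [simp]:
  "poly (map_poly of_rat (p + q)) x = poly (map_poly of_rat p) x + poly (map_poly of_rat q) (x :: 'a::field_char_0)"
  "poly (map_poly of_rat (p * q)) x = poly (map_poly of_rat p) x * poly (map_poly of_rat q) x"
  by (simp_all add: map_poly_hom_add map_poly_hom_mult of_rat_add of_rat_mult)

lemma poly_map_poly_of_int [simp]:
  "poly (map_poly of_int (p + q)) x = poly (map_poly of_int p) x + poly (map_poly of_int q) (x :: 'a::field_char_0)"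
  "poly (map_poly of_int (p * q)) x = poly (map_poly of_int p) x * poly (map_poly of_int q) x"
  by (simp_all add: map_poly_hom_add map_poly_hom_mult)

lemma irrational_linear_independent:
  fixes x :: real
  assumes "x \<notin> \<rat>" "a \<in> \<rat>" "b \<in> \<rat>" "b * x = a"
  shows "a = 0" "b = 0"
proof -
  show "b = 0"
  proof (rule ccontr)
    assume "b \<noteq> 0"
    then have "x = a / b" using assms(4) by (simp add: field_simps)
    then show False using assms by simp
  qed
  then show "a = 0" using assms(4) by simp
qed

lemma poly_degree_1E:
  assumes "degree (p :: 'a::zero poly) < 2"
  obtains a b where "p = [:a, b:]"
proof
  show "p = [:coeff p 0, coeff p 1:]"
    using assms by (intro poly_eqI) (auto simp: coeff_pCons coeff_eq_0 split: nat.split)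
qed

text \<open>
  A rational root would split off a linear factor.
\<close>
lemma irreducible_quadratic_root_irrational:
  fixes p :: "rat poly" and x :: real
  assumes p: "irreducible p" "degree p = 2" "poly (map_poly of_rat p) x = 0"
  shows "x \<notin> \<rat>"
proof
  assume "x \<in> \<rat>"
  then obtain r where r: "x = of_rat r" by (rule Rats_cases)
  have "poly (map_poly of_rat p) (of_rat r :: real) = of_rat (poly p r)"
    by (induction p) (simp_all add: map_poly_pCons of_rat_add of_rat_mult)
  then have "poly p r = 0" using p(3) r by simp
  then obtain q where q: "p = [:- r, 1:] * q" unfolding poly_eq_0_iff_dvd dvd_def by auto
  moreover have "\<not> [:- r, 1:] dvd 1" by (simp add: is_unit_iff_degree)
  ultimately have "q dvd 1" using irreducibleD[OF p(1) q] by blast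
  then have "degree q = 0" "q \<noteq> 0" by (auto elim: is_unit_polyE)
  then have "degree p = 1" unfolding q by (subst degree_mult_eq) auto
  then show False using p(2) by simp
qed

text \<open>
  The remainder of \<open>q\<close> modulo \<open>[:c, b, 1:]\<close> is linear and vanishes at an irrational number, hence is zero.
\<close>
lemma min_poly_unique:
  fixes x :: real
  assumes x: "x \<notin> \<rat>" and eq: "x\<^sup>2 + of_rat b * x + of_rat c = 0"
    and q: "is_min_poly q x"
  shows "q = [:c, b, 1:]"
proof -
  let ?P = "[:c, b, 1:]"
  have P: "poly (map_poly of_rat ?P) x = 0"
    using eq by (simp add: map_poly_pCons algebra_simps power2_eq_square)
  define r where "r = q mod ?P"
  have "degree r < 2"
    using degree_mod_less[of ?P q] by (auto simp: r_def)
  then obtain s t where st: "r = [:s, t:]" by (rule poly_degree_1E)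
  have qr: "q = ?P * (q div ?P) + r" unfolding r_def by (rule mult_div_mod_eq[symmetric])
  have "poly (map_poly of_rat q) x = poly (map_poly of_rat r) x"
    by (subst qr) (use P in \<open>simp only: poly_map_poly_of_rat mult_zero_left add_0\<close>)
  then have "of_rat s + x * of_rat t = 0"
    using q by (simp add: is_min_poly_def st map_poly_pCons)
  then have lin: "of_rat t * x = of_rat (- s)" by (simp add: of_rat_minus algebra_simps)
  have "r = 0"
    using irrational_linear_independent[OF x _ _ lin] by (simp add: st of_rat_minus)
  then have mult: "q = ?P * (q div ?P)" using qr by simp
  moreover have "\<not> ?P dvd 1" by (simp add: is_unit_iff_degree)
  ultimately have "q div ?P dvd 1"
    using irreducibleD[of q ?P "q div ?P"] q by (auto simp: is_min_poly_def)
  then obtain e where e: "q div ?P = [:e:]" by (rule is_unit_polyE)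
  have "lead_coeff q = lead_coeff ?P * lead_coeff [:e:]"
    using mult unfolding e by (metis lead_coeff_mult)
  then have "e = 1" using q by (simp add: is_min_poly_def)
  then show ?thesis using mult e by simp
qed

text \<open>
  Gauss's lemma: pseudo-division of a monic integer polynomial \<open>f\<close> with root \<open>x\<close> by the primitive polynomial
  \<open>u\<close> gives \<open>a * f = u * q\<close> for a power \<open>a\<close> of the leading coefficient of \<open>u\<close>. Comparing contents, \<open>a\<close>
  divides \<open>q\<close>, so the leading coefficient of \<open>u\<close> divides that of \<open>f\<close>.
\<close>
lemma quadratic_algebraic_int_leading_unit:
  fixes x :: real and u :: "int poly"
  assumes x: "x \<notin> \<rat>" "algebraic_int x"
    and u: "degree u = 2" "content u = 1" "poly (map_poly of_int u) x = 0"
  shows "\<bar>lead_coeff u\<bar> = 1"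
proof -
  obtain f :: "int poly" where f: "poly (map_poly of_int f) x = 0" "lead_coeff f = 1"
    using x(2) by (auto simp: algebraic_int_altdef_ipoly)
  define a where "a = lead_coeff u ^ (Suc (degree f) - degree u)"
  obtain q r where qr: "pseudo_divmod f u = (q, r)" by force
  have "u \<noteq> 0" using u(1) by auto
  then have a: "a \<noteq> 0" by (simp add: a_def)
  have div: "smult a f = u * q + r" and "r = 0 \<or> degree r < degree u"
    using pseudo_divmod[OF \<open>u \<noteq> 0\<close> qr] by (auto simp: a_def)
  then have "degree r < 2" using u(1) by auto
  then obtain s t where st: "r = [:s, t:]" by (rule poly_degree_1E)
  have "poly (map_poly of_int (smult a f)) x = poly (map_poly of_int r) x"
    unfolding div using u(3) by simp
  moreover have "map_poly of_int (smult a f) = smult (of_int a :: real) (map_poly of_int f)"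
    by (intro poly_eqI) (simp add: coeff_map_poly)
  ultimately have lin: "of_int t * x = of_int (- s)"
    using f(1) by (simp add: st map_poly_pCons algebra_simps)
  have "r = 0"
    using irrational_linear_independent[OF x(1) _ _ lin] by (simp add: st)
  then have div: "smult a f = u * q" using div by simp
  have "content f = 1"
    using content_dvd_coeff[of f "degree f"] unfolding f(2) is_unit_content_iff .
  then have "content q = \<bar>a\<bar>"
    using arg_cong[OF div, of content] u(2) by (simp add: content_mult)
  then have "\<bar>a\<bar> dvd lead_coeff q" by (metis content_dvd_coeff)
  then obtain e where "lead_coeff q = a * e" by auto
  moreover have "a = lead_coeff u * lead_coeff q"
    using arg_cong[OF div, of lead_coeff] f(2) a by (simp add: lead_coeff_mult)
  ultimately have "a * (lead_coeff u * e) = a * 1" by simp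
  then have "lead_coeff u * e = 1" using a by (simp only: mult_cancel_left) simp
  then show ?thesis by (auto simp: zmult_eq_1_iff)
qed

text \<open>
  Clearing denominators and dividing by the content turns the rational equation into a primitive integer one,
  whose leading coefficient \<open>u2\<close> is a unit; multiplying by \<open>u2\<close> makes it monic.
\<close>
lemma quadratic_algebraic_int_coeffs:
  fixes x :: real
  assumes x: "x \<notin> \<rat>" "algebraic_int x" and eq: "x\<^sup>2 + of_rat b * x + of_rat c = 0"
  obtains k D :: int where "x\<^sup>2 = of_int k * x - of_int D"
proof -
  obtain b0 b1 where b: "b = of_int b0 / of_int b1" "0 < b1" by (metis quotient_of_div quotient_of_denom_pos surj_pair)
  obtain c0 c1 where c: "c = of_int c0 / of_int c1" "0 < c1" by (metis quotient_of_div quotient_of_denom_pos surj_pair)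
  define w where "w = [:c0 * b1, b0 * c1, b1 * c1:]"
  define g where "g = content w"
  define u where "u = primitive_part w"
  have "w \<noteq> 0" using b c by (simp add: w_def)
  then have g: "g \<noteq> 0" by (simp add: g_def)
  have w: "w = smult g u" by (simp add: g_def u_def)
  have "poly (map_poly of_int w) x = of_int (b1 * c1) * (x\<^sup>2 + of_rat b * x + of_rat c)"
    unfolding b(1) c(1) of_rat_divide of_rat_of_int_eq
    using b(2) c(2) by (simp add: w_def map_poly_pCons field_simps power2_eq_square)
  then have "poly (map_poly of_int w) x = 0" using eq by simp
  moreover have "map_poly of_int w = smult (of_int g :: real) (map_poly of_int u)"
    by (intro poly_eqI) (simp add: coeff_map_poly w)
  ultimately have root: "poly (map_poly of_int u) x = 0" using g by simp
  have "degree w = 2" using b c by (simp add: w_def)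
  then have deg: "degree u = 2" using g by (simp add: w)
  have "\<bar>lead_coeff u\<bar> = 1"
    using \<open>w \<noteq> 0\<close> by (intro quadratic_algebraic_int_leading_unit[OF x deg _ root]) (simp add: u_def)
  moreover have "u = [:coeff u 0, coeff u 1, coeff u 2:]"
    using deg by (intro poly_eqI) (auto simp: coeff_pCons coeff_eq_0 numeral_2_eq_2 split: nat.split)
  ultimately obtain u0 u1 u2 where u: "u = [:u0, u1, u2:]" "\<bar>u2\<bar> = 1"
    using deg by metis
  then have unit: "u2 * u2 = 1" by (auto simp: abs_if split: if_splits)
  have "of_int u2 * (of_int u0 + x * (of_int u1 + x * of_int u2)) = 0"
    using root by (simp add: u(1) map_poly_pCons)
  then have "of_int (u2 * u2) * x\<^sup>2 = of_int (- u2 * u1) * x - of_int (u2 * u0)"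
    by (simp add: algebra_simps power2_eq_square)
  then have "x\<^sup>2 = of_int (- u2 * u1) * x - of_int (u2 * u0)"
    by (simp only: unit of_int_1 mult_1_left)
  then show ?thesis by (rule that)
qed

lemma algebraic_int_of_quadratic:
  assumes "x\<^sup>2 = of_int k * x - of_int D"
  shows "algebraic_int (x :: real)"
  unfolding algebraic_int_altdef_ipoly
  using assms by (intro exI[of _ "[:D, - k, 1:]"]) (simp add: map_poly_pCons algebra_simps power2_eq_square)

lemma quadratic_irrationality:
  fixes x :: real
  assumes "has_algebraic_degree x 2"
  obtains b c :: rat where "is_min_poly [:c, b, 1:] x" "x\<^sup>2 + of_rat b * x + of_rat c = 0" "x \<notin> \<rat>"
proof -
  obtain p where p: "is_min_poly p x" "degree p = 2"
    using assms by (auto simp: has_algebraic_degree_def)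
  have "coeff p 2 = 1" using p by (simp add: is_min_poly_def)
  then have p_eq: "p = [:coeff p 0, coeff p 1, 1:]"
    using p(2) by (intro poly_eqI) (auto simp: coeff_pCons coeff_eq_0 numeral_2_eq_2 split: nat.split)
  define b c where "b = coeff p 1" and "c = coeff p 0"
  have p_eq': "p = [:c, b, 1:]" using p_eq by (simp add: b_def c_def)
  have "x\<^sup>2 + of_rat b * x + of_rat c = 0"
    using p(1) unfolding p_eq' is_min_poly_def by (simp add: map_poly_pCons algebra_simps power2_eq_square)
  moreover have "x \<notin> \<rat>"
    using p irreducible_quadratic_root_irrational by (auto simp: is_min_poly_def)
  ultimately show ?thesis using that p(1) p_eq' by blast
qed

lemma galois_conjugates_quadratic:
  fixes x :: real
  assumes deg: "has_algebraic_degree x 2" and eq: "x\<^sup>2 = of_int k * x - of_int D"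
  shows "galois_conjugates x = {of_real x, of_real (of_int k - x)}"
proof -
  obtain b c :: rat where bc: "is_min_poly [:c, b, 1:] x" "x \<notin> \<rat>"
    using quadratic_irrationality[OF deg] by metis
  have eq': "x\<^sup>2 + of_rat (- of_int k) * x + of_rat (of_int D) = 0"
    using eq by (simp add: of_rat_minus)
  note unique = min_poly_unique[OF bc(2) eq']
  have "is_min_poly [:of_int D, - of_int k, 1:] x"
    using bc(1) unique[OF bc(1)] by simp
  then have "galois_conjugates x = {z. poly (map_poly of_rat [:of_int D, - of_int k, 1:]) z = 0}"
    unfolding galois_conjugates_def using unique by blast
  also have "\<dots> = {z. (z - of_real x) * (z - of_real (of_int k - x)) = 0}"
  proof -
    have "of_real (x\<^sup>2) = (of_int k * of_real x - of_int D :: complex)"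
      unfolding eq by simp
    then have "poly (map_poly of_rat [:of_int D, - of_int k, 1:]) z
        = (z - of_real x) * (z - of_real (of_int k - x))" for z :: complex
      by (simp add: map_poly_pCons of_rat_minus algebra_simps power2_eq_square)
    then show ?thesis by simp
  qed
  also have "\<dots> = {of_real x, of_real (of_int k - x)}" by auto
  finally show ?thesis .
qed

text \<open>
  The only conjugate of \<open>\<beta>\<close> other than itself is the second root \<open>k - \<beta>\<close>; it is different from \<open>\<beta>\<close> because
  \<open>\<beta>\<close> is irrational.
\<close>
theorem pisot_quadratic_iff:
  fixes \<beta> :: real
  assumes "\<beta> > 1" and deg: "has_algebraic_degree \<beta> 2"
  shows "pisot \<beta> \<longleftrightarrow> (\<exists>k D :: int. \<beta>\<^sup>2 = of_int k * \<beta> - of_int D \<and> \<bar>of_int k - \<beta>\<bar> < 1)"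
proof -
  obtain b c :: rat where bc: "\<beta>\<^sup>2 + of_rat b * \<beta> + of_rat c = 0" "\<beta> \<notin> \<rat>"
    using quadratic_irrationality[OF deg] by metis
  have conj: "(\<forall>z\<in>galois_conjugates \<beta> - {complex_of_real \<beta>}. norm z < 1) \<longleftrightarrow> \<bar>of_int k - \<beta>\<bar> < 1"
    if eq: "\<beta>\<^sup>2 = of_int k * \<beta> - of_int D" for k D
  proof -
    have "of_int k - \<beta> \<noteq> \<beta>"
    proof
      assume "of_int k - \<beta> = \<beta>"
      then have "2 * \<beta> = of_int k" by simp
      then show False using irrational_linear_independent(2)[OF bc(2), of "of_int k" 2] by simp
    qed
    then have "galois_conjugates \<beta> - {complex_of_real \<beta>} = {of_real (of_int k - \<beta>)}"
      unfolding galois_conjugates_quadratic[OF deg eq] by (auto simp only: of_real_eq_iff)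
    then show ?thesis by (simp only: ball_simps norm_of_real simp_thms)
  qed
  show ?thesis
  proof
    assume pisot: "pisot \<beta>"
    obtain k D :: int where "\<beta>\<^sup>2 = of_int k * \<beta> - of_int D"
      using quadratic_algebraic_int_coeffs[OF bc(2) _ bc(1)] pisot by (auto simp: pisot_def)
    then show "\<exists>k D :: int. \<beta>\<^sup>2 = of_int k * \<beta> - of_int D \<and> \<bar>of_int k - \<beta>\<bar> < 1"
      using pisot conj by (auto simp: pisot_def)
  next
    assume "\<exists>k D :: int. \<beta>\<^sup>2 = of_int k * \<beta> - of_int D \<and> \<bar>of_int k - \<beta>\<bar> < 1"
    then show "pisot \<beta>"
      using conj algebraic_int_of_quadratic assms(1) unfolding pisot_def by blast
  qed
qed

section \<open>Orbits that match force a Pisot slope\<close>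

definition orbit_gap :: "real \<Rightarrow> real \<Rightarrow> nat \<Rightarrow> real" where
  "orbit_gap \<beta> \<alpha> n = orbit_minus \<beta> \<alpha> n - orbit_plus \<beta> \<alpha> n"

lemma abs_orbit_gap_less_1: "\<bar>orbit_gap \<beta> \<alpha> n\<bar> < 1"
  using orbit_plus_in_unit[of \<beta> \<alpha> n] orbit_minus_in_unit[of \<beta> \<alpha> n] by (simp add: orbit_gap_def abs_less_iff)

lemma orbit_gap_1: "\<exists>m :: int. orbit_gap \<beta> \<alpha> (Suc 0) = \<beta> - of_int m"
  by (rule exI[of _ "\<lfloor>\<beta> + \<alpha>\<rfloor> - \<lfloor>\<alpha>\<rfloor>"])
    (simp add: orbit_gap_def orbit_minus_def orbit_plus_def T_def frac_def)

lemma orbit_gap_Suc: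
  assumes "1 \<le> n"
  shows "\<exists>m :: int. orbit_gap \<beta> \<alpha> (Suc n) = \<beta> * orbit_gap \<beta> \<alpha> n - of_int m"
  by (rule exI[of _ "\<lfloor>\<beta> * orbit_minus \<beta> \<alpha> n + \<alpha>\<rfloor> - \<lfloor>\<beta> * orbit_plus \<beta> \<alpha> n + \<alpha>\<rfloor>"])
    (simp add: orbit_gap_def orbit_minus_Suc[OF assms] orbit_plus_Suc T_def frac_def algebra_simps)

text \<open>
  The recursion \<open>\<delta>\<^sub>n\<^sub>+\<^sub>1 = \<beta> \<delta>\<^sub>n - m\<close> with integer \<open>m\<close> is one step of Horner's scheme.
\<close>
lemma orbit_gap_monic_poly:
  "\<exists>f :: int poly. lead_coeff f = 1 \<and> orbit_gap \<beta> \<alpha> (Suc n) = poly (map_poly of_int f) \<beta>"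
proof (induction n)
  case 0
  obtain m where "orbit_gap \<beta> \<alpha> (Suc 0) = \<beta> - of_int m" using orbit_gap_1 by blast
  then show ?case by (intro exI[of _ "[:- m, 1:]"]) (simp add: map_poly_pCons)
next
  case (Suc n)
  then obtain f :: "int poly" where f: "lead_coeff f = 1"
      "orbit_gap \<beta> \<alpha> (Suc n) = poly (map_poly of_int f) \<beta>"
    by blast
  obtain m where m: "orbit_gap \<beta> \<alpha> (Suc (Suc n)) = \<beta> * orbit_gap \<beta> \<alpha> (Suc n) - of_int m"
    using orbit_gap_Suc[of "Suc n"] by auto
  have "f \<noteq> 0" using f(1) by auto
  then show ?case using f m by (intro exI[of _ "pCons (- m) f"]) (simp add: map_poly_pCons)
qed

lemma int_poly_at_quadratic:
  assumes "x\<^sup>2 = of_int k * x - of_int D"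
  shows "\<exists>p q :: int. poly (map_poly of_int f) x = of_int p * x + of_int q"
proof (induction f)
  case 0
  show ?case by (intro exI[of _ 0]) simp
next
  case (pCons a f)
  then obtain p q :: int where "poly (map_poly of_int f) x = of_int p * x + of_int q" by blast
  then have "poly (map_poly of_int (pCons a f)) x = of_int a + of_int p * x\<^sup>2 + of_int q * x"
    by (simp add: map_poly_pCons algebra_simps power2_eq_square)
  also have "\<dots> = of_int (p * k + q) * x + of_int (a - p * D)"
    unfolding assms by (simp add: algebra_simps)
  finally show ?case by blast
qed

text \<open>
  Just before the first zero of the gap, \<open>\<beta>\<close> times the gap is an integer. In the ring generated by \<open>\<beta>\<close> the
  only elements with this property are the integer multiples of the conjugate \<open>k - \<beta>\<close>; as the gap is
  nonzero and less than \<open>1\<close> in absolute value, so is the conjugate.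
\<close>
lemma pisot_of_matching:
  assumes \<beta>: "\<beta> > 1" and deg: "has_algebraic_degree \<beta> 2" and "matching \<beta> \<alpha>"
  shows "pisot \<beta>"
proof -
  obtain b c :: rat where bc: "\<beta>\<^sup>2 + of_rat b * \<beta> + of_rat c = 0" and irr: "\<beta> \<notin> \<rat>"
    using quadratic_irrationality[OF deg] by metis
  let ?\<delta> = "orbit_gap \<beta> \<alpha>"
  define m where "m = (LEAST m. ?\<delta> (Suc m) = 0)"
  \<comment> \<open>Indices are shifted by one because \<open>orbit_plus\<close> and \<open>orbit_minus\<close> are the orbits of \<open>0\<^sup>+\<close> and \<open>0\<^sup>-\<close>
    only from time \<open>1\<close> on.\<close>
  have "\<exists>m. ?\<delta> (Suc m) = 0"
    using assms(3) unfolding matching_def orbit_gap_def by (metis Suc_le_D One_nat_def diff_self)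
  then have m: "?\<delta> (Suc m) = 0" and least: "\<And>j. j < m \<Longrightarrow> ?\<delta> (Suc j) \<noteq> 0"
    unfolding m_def by (auto intro: LeastI_ex dest: not_less_Least)
  obtain f :: "int poly" where "lead_coeff f = 1" "?\<delta> (Suc m) = poly (map_poly of_int f) \<beta>"
    using orbit_gap_monic_poly by blast
  then have "algebraic_int \<beta>" using m by (auto simp: algebraic_int_altdef_ipoly)
  then obtain k D :: int where kD: "\<beta>\<^sup>2 = of_int k * \<beta> - of_int D"
    using quadratic_algebraic_int_coeffs[OF irr _ bc] by blast
  have "m \<noteq> 0"
  proof
    assume "m = 0"
    moreover obtain c where "?\<delta> (Suc 0) = \<beta> - of_int c" using orbit_gap_1 by blast
    ultimately have "\<beta> = of_int c" using m by simp
    then show False using irr by simp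
  qed
  then obtain n where n: "m = Suc n" by (cases m) auto
  obtain c where "?\<delta> (Suc m) = \<beta> * ?\<delta> (Suc n) - of_int c"
    using orbit_gap_Suc[of "Suc n"] n by auto
  then have c: "\<beta> * ?\<delta> (Suc n) = of_int c" using m by simp
  obtain p q :: int where pq: "?\<delta> (Suc n) = of_int p * \<beta> + of_int q"
    using orbit_gap_monic_poly int_poly_at_quadratic[OF kD] by metis
  have "of_int c = of_int p * \<beta>\<^sup>2 + of_int q * \<beta>"
    using c pq by (simp add: algebra_simps power2_eq_square)
  then have lin: "of_int (p * k + q) * \<beta> = of_int (c + p * D)"
    unfolding kD by (simp add: algebra_simps)
  have "real_of_int (p * k + q) = 0"
    by (rule irrational_linear_independent(2)[OF irr _ _ lin]) auto
  then have "q = - (p * k)" by linarith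
  then have gap: "?\<delta> (Suc n) = - (of_int p * (of_int k - \<beta>))"
    using pq by (simp add: algebra_simps)
  moreover have "?\<delta> (Suc n) \<noteq> 0" using least[of n] n by simp
  ultimately have "1 \<le> \<bar>real_of_int p\<bar>" by auto
  then have "1 * \<bar>of_int k - \<beta>\<bar> \<le> \<bar>real_of_int p\<bar> * \<bar>of_int k - \<beta>\<bar>"
    by (rule mult_right_mono) simp
  also have "\<dots> = \<bar>?\<delta> (Suc n)\<bar>" using gap by (simp add: abs_mult)
  also have "\<dots> < 1" by (rule abs_orbit_gap_less_1)
  finally show ?thesis
    using kD unfolding pisot_quadratic_iff[OF \<beta> deg] by auto
qed

section \<open>The dichotomy and the dimension\<close>

text \<open>
  Both inequalities for \<open>k\<close> come from the value of the minimal polynomial at a point that separates the two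
  roots in modulus: at \<open>1\<close> for a positive conjugate and at \<open>-1\<close> for a negative one. In terms of \<open>\<kappa>\<close> they
  read \<open>0 < (\<beta> - 1) * (1 - \<kappa>)\<close> and \<open>0 < (\<beta> + 1) * (1 - \<kappa>)\<close>.
\<close>
lemma pisot_conjugate_gap:
  assumes \<beta>: "\<beta> > 1" and deg: "has_algebraic_degree \<beta> 2" and "pisot \<beta>"
  obtains k d :: int and \<kappa> v where "conjugate_gap \<beta> \<kappa> v" "\<beta> * \<kappa> = of_int d" "k > 0" "d > 0"
    "\<beta>^2 - of_int k * \<beta> + of_int d = 0 \<and> k > d + 1 \<or> \<beta>^2 - of_int k * \<beta> - of_int d = 0 \<and> k > d - 1"
proof -
  obtain k D :: int where kD: "\<beta>\<^sup>2 = of_int k * \<beta> - of_int D" and small: "\<bar>of_int k - \<beta>\<bar> < 1"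
    using assms pisot_quadratic_iff by blast
  have irr: "\<beta> \<notin> \<rat>" using quadratic_irrationality[OF deg] by metis
  define \<kappa> where "\<kappa> = \<bar>of_int k - \<beta>\<bar>"
  have "of_int k \<noteq> \<beta>" using irr by auto
  then have \<kappa>: "0 < \<kappa>" "\<kappa> < 1" using small by (auto simp: \<kappa>_def)
  have k: "k > 0" using small \<beta> by linarith
  have norm: "\<beta> * (of_int k - \<beta>) = of_int D"
    using kD by (simp add: algebra_simps power2_eq_square)
  show ?thesis
  proof (cases "\<beta> < of_int k")
    case True
    then have \<kappa>_eq: "\<kappa> = of_int k - \<beta>" by (simp add: \<kappa>_def)
    have D: "\<beta> * \<kappa> = of_int D" using norm by (simp add: \<kappa>_eq)
    have "0 < (\<beta> - 1) * (1 - \<kappa>)" "0 < \<beta> * \<kappa>" using \<beta> \<kappa> by (auto intro: mult_pos_pos)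
    then have "real_of_int (D + 1) < of_int k" "0 < real_of_int D"
      using D by (simp_all add: \<kappa>_eq algebra_simps)
    then have "k > D + 1" "D > 0" by linarith+
    moreover have "conjugate_gap \<beta> \<kappa> 0"
      using \<kappa> D by unfold_locales (auto simp: \<kappa>_eq)
    ultimately show ?thesis using that[of \<kappa> 0 D k] D k kD by simp
  next
    case False
    then have \<kappa>_eq: "\<kappa> = \<beta> - of_int k" by (simp add: \<kappa>_def)
    have D: "\<beta> * \<kappa> = of_int (- D)" using norm by (simp add: \<kappa>_eq algebra_simps)
    have "0 < (\<beta> + 1) * (1 - \<kappa>)" "0 < \<beta> * \<kappa>" using \<beta> \<kappa> by (auto intro: mult_pos_pos)
    then have "real_of_int (- D - 1) < of_int k" "0 < real_of_int (- D)"
      using D by (simp_all add: \<kappa>_eq algebra_simps)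
    then have "k > - D - 1" "- D > 0" by linarith+
    moreover have "conjugate_gap \<beta> \<kappa> \<kappa>"
      using \<kappa> D by unfold_locales (auto simp: \<kappa>_eq)
    ultimately show ?thesis using that[of \<kappa> \<kappa> "- D" k] D k kD by simp
  qed
qed

theorem theorem1p1:
  fixes \<beta> :: real
  assumes "\<beta> > 1" and "has_algebraic_degree \<beta> 2"
  shows "((\<exists>\<alpha>\<in>{0..1}. matching \<beta> \<alpha>) \<longleftrightarrow> pisot \<beta>) \<and>
    (pisot \<beta> \<longrightarrow>
      (\<exists>k d :: int. k > 0 \<and> d > 0 \<and>
        ((\<beta>^2 - of_int k * \<beta> + of_int d = 0 \<and> k > d + 1) \<or>
         (\<beta>^2 - of_int k * \<beta> - of_int d = 0 \<and> k > d - 1)) \<and>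
        hausdorff_dim (non_matching_set \<beta>) = ereal (ln (of_int d) / ln \<beta>)))"
proof (intro conjI iffI impI)
  assume "\<exists>\<alpha>\<in>{0..1}. matching \<beta> \<alpha>"
  then show "pisot \<beta>" using pisot_of_matching assms by blast
next
  assume "pisot \<beta>"
  then obtain k d :: int and \<kappa> v where "conjugate_gap \<beta> \<kappa> v" and kd: "\<beta> * \<kappa> = of_int d" "k > 0" "d > 0"
    "\<beta>^2 - of_int k * \<beta> + of_int d = 0 \<and> k > d + 1 \<or> \<beta>^2 - of_int k * \<beta> - of_int d = 0 \<and> k > d - 1"
    using pisot_conjugate_gap[OF assms] by metis
  then interpret conjugate_gap \<beta> \<kappa> v by simp
  show "\<exists>\<alpha>\<in>{0..1}. matching \<beta> \<alpha>" by (rule matching_exists)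
  have "hausdorff_dim (non_matching_set \<beta>) = ereal (ln (of_int d) / ln \<beta>)"
    using kd assms(1) by (intro hausdorff_dim_non_matching_set) auto
  with kd show "\<exists>k d :: int. k > 0 \<and> d > 0 \<and>
        ((\<beta>^2 - of_int k * \<beta> + of_int d = 0 \<and> k > d + 1) \<or>
         (\<beta>^2 - of_int k * \<beta> - of_int d = 0 \<and> k > d - 1)) \<and>
        hausdorff_dim (non_matching_set \<beta>) = ereal (ln (of_int d) / ln \<beta>)"
    by blast
qed

end
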